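(* Let $K \subset \hat{\mathbb{C}}$ be a continuum. Then the hyperbolic volume of the hyperbolic convex hull $CH(K)\subset\mathbb{H}^3$ is either $0$ or $\infty$, and it is $0$ if and only if $K$ is contained in a circle in $\hat{\mathbb{C}}$.
   Context: $\mathbb{H}^3$ is hyperbolic 3-space, whose sphere at infinity is identified with the Riemann sphere $\hat{\mathbb{C}}=\mathbb{C}\cup\{\infty\}$. A continuum is a compact, connected set. A circle in $\hat{\mathbb{C}}$ is a round circle in $\mathbb{C}$ or a Euclidean line in $\mathbb{C}$ together with $\infty$. For a closed set $E\subset\hat{\mathbb{C}}$, the hyperbolic convex hull $CH(E)\subset\mathbb{H}^3$ is the hyperbolic convex hull of the union of all hyperbolic geodesics in $\mathbb{H}^3$ both of whose endpoints at infinity lie in $E$ (so it is empty if $E$ has at most one point). *)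

theory Defs
  imports "HOL-Analysis.Analysis"
begin

text \<open>The Riemann sphere is the one-point compactification of the complex plane;
  \<^term>\<open>None\<close> is the point at infinity.\<close>

definition riemann_sphere :: "complex option topology" where
  "riemann_sphere = Alexandroff_compactification euclidean"

definition continuum :: "complex option set \<Rightarrow> bool" where
  "continuum K \<longleftrightarrow> compactin riemann_sphere K \<and> connectedin riemann_sphere K"

definition sphere_circle :: "complex option set \<Rightarrow> bool" where
  "sphere_circle C \<longleftrightarrow>
     (\<exists>c r. r > 0 \<and> C = Some ` sphere c r) \<or>
     (\<exists>a v. v \<noteq> 0 \<and> C = insert None (Some ` range (\<lambda>t::real. a + of_real t * v)))"

text \<open>Hyperbolic 3-space in the upper half-space model, with Riemannian metric
  \<open>(|dz|\<^sup>2 + dt\<^sup>2) / t\<^sup>2\<close> at the point \<open>(z, t)\<close>. Its distance function satisfies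
  \<open>cosh d(p, q) = 1 + |p - q|\<^sup>2 / (2 t\<^sub>p t\<^sub>q)\<close> and its volume form is the Euclidean one
  divided by \<open>t\<^sup>3\<close>.\<close>

definition hyp_space :: "(complex \<times> real) set" where
  "hyp_space = {p. snd p > 0}"

definition hyp_dist :: "complex \<times> real \<Rightarrow> complex \<times> real \<Rightarrow> real" where
  "hyp_dist p q = arcosh (1 + (dist p q)\<^sup>2 / (2 * snd p * snd q))"

text \<open>The base measure is the completed Lebesgue measure, so every subset of a null set
  is measurable with volume 0.\<close>

definition hyp_volume :: "(complex \<times> real) measure" where
  "hyp_volume = density lebesgue (\<lambda>p. ennreal (1 / snd p ^ 3) * indicator hyp_space p)"

definition hyp_segment :: "complex \<times> real \<Rightarrow> complex \<times> real \<Rightarrow> (complex \<times> real) set" where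
  "hyp_segment p q = {r \<in> hyp_space. hyp_dist p r + hyp_dist r q = hyp_dist p q}"

definition hyp_convex :: "(complex \<times> real) set \<Rightarrow> bool" where
  "hyp_convex S \<longleftrightarrow> S \<subseteq> hyp_space \<and> (\<forall>p\<in>S. \<forall>q\<in>S. hyp_segment p q \<subseteq> S)"

text \<open>Complete geodesics are parametrised by arc length, as isometric embeddings of the
  real line.\<close>

definition hyp_geodesic :: "(real \<Rightarrow> complex \<times> real) \<Rightarrow> bool" where
  "hyp_geodesic \<gamma> \<longleftrightarrow>
     range \<gamma> \<subseteq> hyp_space \<and> (\<forall>s t. hyp_dist (\<gamma> s) (\<gamma> t) = \<bar>s - t\<bar>)"

text \<open>Convergence to a point of the sphere at infinity: the finite point \<open>z\<close> is identified
  with the boundary point \<open>(z, 0)\<close> of the half-space.\<close>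

definition tends_to_ideal ::
    "(real \<Rightarrow> complex \<times> real) \<Rightarrow> complex option \<Rightarrow> real filter \<Rightarrow> bool" where
  "tends_to_ideal \<gamma> \<zeta> F =
     (case \<zeta> of None \<Rightarrow> filterlim \<gamma> at_infinity F
              | Some z \<Rightarrow> (\<gamma> \<longlongrightarrow> (z, 0)) F)"

definition CH :: "complex option set \<Rightarrow> (complex \<times> real) set" where
  "CH E = hyp_convex hull
     \<Union>{range \<gamma> | \<gamma>. hyp_geodesic \<gamma> \<and>
          (\<exists>\<zeta>\<in>E. tends_to_ideal \<gamma> \<zeta> at_bot) \<and> (\<exists>\<zeta>\<in>E. tends_to_ideal \<gamma> \<zeta> at_top)}"

end

theory Submission
  imports Defs
begin

text \<open>The map \<open>(z, t) \<mapsto> (z, |z|\<^sup>2 + t\<^sup>2)\<close> carries the half-space onto the region above a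
  paraboloid and geodesics to chords, so that \<open>CH K\<close> becomes, up to its boundary, the Euclidean
  convex hull of the lift of \<open>K\<close> to the paraboloid; circles lift to plane sections. If \<open>K\<close> lies
  in a circle, the hull is therefore contained in a plane and has volume \<open>0\<close>. Otherwise it contains a
  ball, hence a cone of fixed aperture with apex at each finite point of \<open>K\<close>; the part of such a
  cone at scale \<open>s\<close> has hyperbolic volume at least a constant times \<open>s\<close>. Since \<open>K\<close> is connected it
  contains about \<open>1/s\<close> points at distance \<open>s\<close> from each other, so the part of \<open>CH K\<close> at height
  comparable to \<open>sqrt s\<close> has volume bounded below for every \<open>s\<close>, which is impossible in finite
  volume.\<close>

section \<open>The paraboloid model\<close>

definition paraboloid :: "complex \<times> real \<Rightarrow> complex \<times> real" where
  "paraboloid p = (fst p, (norm p)\<^sup>2)"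

text \<open>The value of \<open>paraboloid\<close> at the boundary point \<open>(z, 0)\<close>. The
  ideal point \<open>None\<close> has no lift and is treated separately.\<close>

definition lift :: "complex \<Rightarrow> complex \<times> real" where
  "lift z = (z, (norm z)\<^sup>2)"

lemma norm_prod_sq: "(norm p)\<^sup>2 = (norm (fst p))\<^sup>2 + (snd p)\<^sup>2" for p :: "complex \<times> real"
  by (cases p) (simp add: norm_Pair)

lemma hyp_dist_arg_ge1:
  assumes "p \<in> hyp_space" "q \<in> hyp_space"
  shows "1 + (dist p q)\<^sup>2 / (2 * snd p * snd q) \<ge> 1"
  using assms by (simp add: hyp_space_def)

text \<open>The numerator is bilinear in the vectors \<open>(1, z, h)\<close> with
  \<open>h = (norm p)^2\<close>, and on the diagonal it equals the squared height. The quotient is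
  thus a normalised Lorentz product.\<close>

lemma cosh_hyp_dist:
  assumes "p \<in> hyp_space" "q \<in> hyp_space"
  shows "cosh (hyp_dist p q) = (((norm p)\<^sup>2 + (norm q)\<^sup>2) / 2 - fst p \<bullet> fst q) / (snd p * snd q)"
proof -
  have "cosh (hyp_dist p q) = 1 + (dist p q)\<^sup>2 / (2 * snd p * snd q)"
    unfolding hyp_dist_def using hyp_dist_arg_ge1[OF assms] by (simp only: cosh_arcosh_real)
  also have "(dist p q)\<^sup>2 = (norm p)\<^sup>2 + (norm q)\<^sup>2 - 2 * (fst p \<bullet> fst q) - 2 * (snd p * snd q)"
    by (simp add: dist_norm power2_norm_eq_inner inner_prod_def algebra_simps inner_commute)
  finally show ?thesis
    using assms by (simp add: hyp_space_def field_simps)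
qed

lemma hyp_dist_nonneg:
  assumes "p \<in> hyp_space" "q \<in> hyp_space"
  shows "hyp_dist p q \<ge> 0"
  unfolding hyp_dist_def by (rule arcosh_nonneg_real[OF hyp_dist_arg_ge1[OF assms]])

text \<open>Let \<open>u\<close>, \<open>v\<close> be unit timelike vectors with Lorentz product
  \<open>C\<close>. Then \<alpha> \<open>u\<close> + \<beta> \<open>v\<close> is a unit vector
  between them, and the two arguments on the left are its products with \<open>u\<close> and
  \<open>v\<close>. Both hyperbolic sines are multiples of \<open>sqrt (C^2 - 1)\<close>, so the
  addition formula for \<open>cosh\<close> returns \<open>C\<close>.\<close>

lemma arcosh_add_eq:
  fixes \<alpha> \<beta> C :: real
  assumes "\<alpha> \<ge> 0" "\<beta> \<ge> 0" "C \<ge> 1" and unit: "\<alpha>\<^sup>2 + \<beta>\<^sup>2 + 2 * \<alpha> * \<beta> * C = 1"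
  shows "arcosh (\<alpha> + \<beta> * C) + arcosh (\<alpha> * C + \<beta>) = arcosh C"
proof -
  let ?u = "\<alpha> + \<beta> * C" and ?v = "\<alpha> * C + \<beta>"
  have u2: "?u\<^sup>2 - 1 = \<beta>\<^sup>2 * (C\<^sup>2 - 1)" and v2: "?v\<^sup>2 - 1 = \<alpha>\<^sup>2 * (C\<^sup>2 - 1)"
    using unit by algebra+
  have C2: "C\<^sup>2 - 1 \<ge> 0" using \<open>C \<ge> 1\<close> by (simp add: power2_eq_square mult_ge1_I)
  have "?u\<^sup>2 \<ge> 1" "?v\<^sup>2 \<ge> 1"
    using u2 v2 mult_nonneg_nonneg[OF zero_le_power2 C2] by (metis diff_ge_0_iff_ge)+
  moreover have "?u \<ge> 0" "?v \<ge> 0" using assms by auto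
  ultimately have uv: "?u \<ge> 1" "?v \<ge> 1" by (auto simp: one_le_power power2_le_iff_abs_le intro: power2_le_imp_le)
  have "sinh (arcosh ?u) * sinh (arcosh ?v) = \<alpha> * \<beta> * (C\<^sup>2 - 1)"
    using uv C2 assms by (simp add: sinh_arcosh_real u2 v2 real_sqrt_mult)
  then have "cosh (arcosh ?u + arcosh ?v) = ?u * ?v + \<alpha> * \<beta> * (C\<^sup>2 - 1)"
    using uv by (simp add: cosh_add)
  also have "\<dots> = C" using unit by algebra
  finally show ?thesis
    using uv arcosh_cosh_real[of "arcosh ?u + arcosh ?v"] by (simp add: add_nonneg_nonneg)
qed

text \<open>A null vector orthogonal to a timelike one vanishes. The form is
  \<open>a * b - (norm w)^2\<close>, the timelike vector is \<open>(1, z, h)\<close>, and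
  Cauchy-Schwarz makes a sum of two nonnegative terms nonpositive.\<close>

lemma null_orthogonal_eq_0:
  fixes z w :: complex and a b h :: real
  assumes pos: "(norm z)\<^sup>2 < h" and null: "a * b = (norm w)\<^sup>2" and orth: "a * h + b = 2 * (w \<bullet> z)"
  shows "a = 0" "b = 0" "w = 0"
proof -
  have "(w \<bullet> z)\<^sup>2 \<le> (norm w)\<^sup>2 * (norm z)\<^sup>2"
    using Cauchy_Schwarz_ineq[of w z] by (simp add: power2_norm_eq_inner)
  moreover have "(a * h + b)\<^sup>2 = (a * h - b)\<^sup>2 + 4 * (a * b) * h" by algebra
  ultimately have "(a * h - b)\<^sup>2 + 4 * ((norm w)\<^sup>2 * (h - (norm z)\<^sup>2)) \<le> 0"
    unfolding null orth by (simp add: power_mult_distrib algebra_simps)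
  moreover have "(norm w)\<^sup>2 * (h - (norm z)\<^sup>2) \<ge> 0" using pos by simp
  ultimately have "(a * h - b)\<^sup>2 = 0" "(norm w)\<^sup>2 * (h - (norm z)\<^sup>2) = 0"
    using zero_le_power2[of "a * h - b"] by linarith+
  then show "w = 0" using pos by simp
  with \<open>(a * h - b)\<^sup>2 = 0\<close> orth have "a * h = 0" "b = 0" by simp_all
  moreover have "h > 0" using pos zero_le_power2[of "norm z"] by linarith
  ultimately show "a = 0" "b = 0" by simp_all
qed

text \<open>In the coordinates of \<^const>\<open>paraboloid\<close> hyperbolic 3-space becomes the projective model
  over a paraboloid: \<open>cosh d\<close> is the normalised Lorentz form of the vectors \<open>(1, z, h)\<close>, and
  geodesics are straight.\<close>

lemma hyp_segment_iff:
  assumes p: "p \<in> hyp_space" and q: "q \<in> hyp_space" and r: "r \<in> hyp_space"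
  shows "r \<in> hyp_segment p q \<longleftrightarrow> paraboloid r \<in> closed_segment (paraboloid p) (paraboloid q)"
proof
  assume "paraboloid r \<in> closed_segment (paraboloid p) (paraboloid q)"
  then obtain \<tau> where \<tau>: "0 \<le> \<tau>" "\<tau> \<le> 1"
    and "paraboloid r = (1 - \<tau>) *\<^sub>R paraboloid p + \<tau> *\<^sub>R paraboloid q"
    by (auto simp: in_segment)
  then have rz: "fst r = (1 - \<tau>) *\<^sub>R fst p + \<tau> *\<^sub>R fst q"
    and rh: "(norm r)\<^sup>2 = (1 - \<tau>) * (norm p)\<^sup>2 + \<tau> * (norm q)\<^sup>2"
    by (auto simp: paraboloid_def)
  define a b c where "a = snd p" and "b = snd q" and "c = snd r"
  have abc: "a > 0" "b > 0" "c > 0" using p q r by (auto simp: a_def b_def c_def hyp_space_def)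
  define B where "B = ((norm p)\<^sup>2 + (norm q)\<^sup>2) / 2 - fst p \<bullet> fst q"
  define C where "C = B / (a * b)"
  have np: "fst p \<bullet> fst p = (norm p)\<^sup>2 - a\<^sup>2" and nq: "fst q \<bullet> fst q = (norm q)\<^sup>2 - b\<^sup>2"
    and nr: "fst r \<bullet> fst r = (norm r)\<^sup>2 - c\<^sup>2"
    by (simp_all add: norm_prod_sq a_def b_def c_def power2_norm_eq_inner)
  have pr: "((norm p)\<^sup>2 + (norm r)\<^sup>2) / 2 - fst p \<bullet> fst r = (1 - \<tau>) * a\<^sup>2 + \<tau> * B"
    unfolding rz rh inner_add_right inner_scaleR_right np B_def by (simp add: field_simps)
  have rq: "((norm r)\<^sup>2 + (norm q)\<^sup>2) / 2 - fst r \<bullet> fst q = (1 - \<tau>) * B + \<tau> * b\<^sup>2"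
    unfolding rz rh inner_add_left inner_scaleR_left nq B_def by (simp add: field_simps)
  \<comment> \<open>The Lorentz square of the convex combination of the vectors of \<open>p\<close>
    and \<open>q\<close>: diagonal terms \<open>a^2\<close>, \<open>b^2\<close> and mixed term
    \<open>B\<close>.\<close>
  have c2: "c\<^sup>2 = (1 - \<tau>)\<^sup>2 * a\<^sup>2 + \<tau>\<^sup>2 * b\<^sup>2 + 2 * \<tau> * (1 - \<tau>) * B"
  proof -
    have "c\<^sup>2 = (norm r)\<^sup>2 - fst r \<bullet> fst r" using nr by simp
    also have "fst r \<bullet> fst r = (1 - \<tau>)\<^sup>2 * (fst p \<bullet> fst p) + \<tau>\<^sup>2 * (fst q \<bullet> fst q)
        + 2 * \<tau> * (1 - \<tau>) * (fst p \<bullet> fst q)"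
      unfolding rz by (simp add: inner_add_left inner_add_right inner_commute power2_eq_square algebra_simps)
    finally show ?thesis
      unfolding rh np nq B_def by (simp add: field_simps power2_eq_square)
  qed
  \<comment> \<open>The coefficients of the unit vector of \<open>r\<close> with respect to the unit
    vectors of \<open>p\<close> and \<open>q\<close>.\<close>
  define \<alpha> \<beta> where "\<alpha> = (1 - \<tau>) * a / c" and "\<beta> = \<tau> * b / c"
  have coshpq: "cosh (hyp_dist p q) = C"
    unfolding cosh_hyp_dist[OF p q] C_def B_def a_def b_def ..
  then have "C \<ge> 1" by (metis cosh_real_ge_1)
  have "cosh (hyp_dist p r) = ((1 - \<tau>) * a\<^sup>2 + \<tau> * B) / (a * c)"
    unfolding cosh_hyp_dist[OF p r] pr a_def c_def ..
  also have "\<dots> = \<alpha> + \<beta> * C"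
    using abc by (simp add: \<alpha>_def \<beta>_def C_def field_simps power2_eq_square)
  finally have 1: "hyp_dist p r = arcosh (\<alpha> + \<beta> * C)"
    using hyp_dist_nonneg[OF p r] by (metis arcosh_cosh_real)
  have "cosh (hyp_dist r q) = ((1 - \<tau>) * B + \<tau> * b\<^sup>2) / (c * b)"
    unfolding cosh_hyp_dist[OF r q] rq b_def c_def ..
  also have "\<dots> = \<alpha> * C + \<beta>"
    using abc by (simp add: \<alpha>_def \<beta>_def C_def field_simps power2_eq_square)
  finally have 2: "hyp_dist r q = arcosh (\<alpha> * C + \<beta>)"
    using hyp_dist_nonneg[OF r q] by (metis arcosh_cosh_real)
  have 3: "hyp_dist p q = arcosh C"
    using coshpq hyp_dist_nonneg[OF p q] by (metis arcosh_cosh_real)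
  have "\<alpha>\<^sup>2 + \<beta>\<^sup>2 + 2 * \<alpha> * \<beta> * C
      = ((1 - \<tau>)\<^sup>2 * a\<^sup>2 + \<tau>\<^sup>2 * b\<^sup>2 + 2 * \<tau> * (1 - \<tau>) * B) / c\<^sup>2"
    unfolding \<alpha>_def \<beta>_def C_def using abc by (simp add: field_simps power2_eq_square)
  then have "\<alpha>\<^sup>2 + \<beta>\<^sup>2 + 2 * \<alpha> * \<beta> * C = 1"
    unfolding c2[symmetric] using abc by simp
  then have "hyp_dist p r + hyp_dist r q = hyp_dist p q"
    unfolding 1 2 3 using abc \<tau> \<open>C \<ge> 1\<close> by (intro arcosh_add_eq) (auto simp: \<alpha>_def \<beta>_def)
  then show "r \<in> hyp_segment p q" using r by (simp add: hyp_segment_def)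
next
  assume "r \<in> hyp_segment p q"
  define x y where "x = hyp_dist p r" and "y = hyp_dist r q"
  have xy: "hyp_dist p q = x + y" "x \<ge> 0" "y \<ge> 0"
    using \<open>r \<in> hyp_segment p q\<close> hyp_dist_nonneg p q r by (auto simp: hyp_segment_def x_def y_def)
  define a b c where "a = snd p" and "b = snd q" and "c = snd r"
  have abc: "a > 0" "b > 0" "c > 0" using p q r by (auto simp: a_def b_def c_def hyp_space_def)
  define hp hq hr where "hp = (norm p)\<^sup>2" and "hq = (norm q)\<^sup>2" and "hr = (norm r)\<^sup>2"
  define zp zq zr where "zp = fst p" and "zq = fst q" and "zr = fst r"
  have np: "zp \<bullet> zp = hp - a\<^sup>2" and nq: "zq \<bullet> zq = hq - b\<^sup>2" and nr: "zr \<bullet> zr = hr - c\<^sup>2"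
    by (simp_all add: norm_prod_sq a_def b_def c_def hp_def hq_def hr_def zp_def zq_def zr_def power2_norm_eq_inner)
  have pq: "zp \<bullet> zq = (hp + hq) / 2 - a * b * cosh (x + y)"
    unfolding xy(1)[symmetric] cosh_hyp_dist[OF p q] using abc by (simp add: a_def b_def hp_def hq_def zp_def zq_def)
  have pr: "zp \<bullet> zr = (hp + hr) / 2 - a * c * cosh x"
    unfolding x_def cosh_hyp_dist[OF p r] using abc by (simp add: a_def c_def hp_def hr_def zp_def zr_def)
  have rq: "zr \<bullet> zq = (hr + hq) / 2 - c * b * cosh y"
    unfolding y_def cosh_hyp_dist[OF r q] using abc by (simp add: b_def c_def hr_def hq_def zr_def zq_def)
  \<comment> \<open>The combination \<open>sinh (x + y) w - sinh y u - sinh x v\<close> of the unit vectors of \<open>r\<close>, \<open>p\<close>, \<open>q\<close>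
    is null and orthogonal to \<open>u\<close>, hence zero.\<close>
  define k l m where "k = sinh (x + y) / c" and "l = sinh y / a" and "m = sinh x / b"
  let ?w = "k *\<^sub>R zr - l *\<^sub>R zp - m *\<^sub>R zq"
  have hyp: "(cosh x)\<^sup>2 = (sinh x)\<^sup>2 + 1" "(cosh y)\<^sup>2 = (sinh y)\<^sup>2 + 1"
    using hyperbolic_pythagoras[of x] hyperbolic_pythagoras[of y] by auto
  have kc: "k * c = sinh x * cosh y + cosh x * sinh y" and la: "l * a = sinh y" and mb: "m * b = sinh x"
    using abc by (simp_all add: k_def l_def m_def sinh_add)
  have null: "(k - l - m) * (k * hr - l * hp - m * hq) = (norm ?w)\<^sup>2"
  proof -
    have "(norm ?w)\<^sup>2 = k\<^sup>2 * (zr \<bullet> zr) + l\<^sup>2 * (zp \<bullet> zp) + m\<^sup>2 * (zq \<bullet> zq) - 2 * k * l * (zp \<bullet> zr)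
      - 2 * k * m * (zr \<bullet> zq) + 2 * l * m * (zp \<bullet> zq)"
      unfolding power2_norm_eq_inner
      by (simp add: inner_diff_left inner_diff_right inner_commute power2_eq_square algebra_simps)
    also have "\<dots> = (k - l - m) * (k * hr - l * hp - m * hq) -
      ((k*c)\<^sup>2 + (l*a)\<^sup>2 + (m*b)\<^sup>2 - 2 * (k*c) * (l*a) * cosh x - 2 * (k*c) * (m*b) * cosh y
        + 2 * (l*a) * (m*b) * cosh (x + y))"
      unfolding np nq nr pq pr rq by (simp add: field_simps power2_eq_square)
    also have "(k*c)\<^sup>2 + (l*a)\<^sup>2 + (m*b)\<^sup>2 - 2 * (k*c) * (l*a) * cosh x - 2 * (k*c) * (m*b) * cosh y
        + 2 * (l*a) * (m*b) * cosh (x + y) = 0"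
      unfolding kc la mb cosh_add using hyp by algebra
    finally show ?thesis by simp
  qed
  have orth: "(k - l - m) * hp + (k * hr - l * hp - m * hq) = 2 * (?w \<bullet> zp)"
  proof -
    have "2 * (?w \<bullet> zp) = 2 * k * (zp \<bullet> zr) - 2 * l * (zp \<bullet> zp) - 2 * m * (zp \<bullet> zq)"
      by (simp add: inner_diff_left inner_commute algebra_simps)
    also have "\<dots> = (k - l - m) * hp + (k * hr - l * hp - m * hq)
        - 2 * a * ((k*c) * cosh x - (l*a) - (m*b) * cosh (x + y))"
      unfolding np pr pq by (simp add: field_simps power2_eq_square)
    also have "(k*c) * cosh x - (l*a) - (m*b) * cosh (x + y) = 0"
      unfolding kc la mb cosh_add using hyp by algebra
    finally show ?thesis by simp
  qed
  have "(norm zp)\<^sup>2 < hp" using np abc by (simp add: power2_norm_eq_inner)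
  note zero = null_orthogonal_eq_0[OF this null orth]
  show "paraboloid r \<in> closed_segment (paraboloid p) (paraboloid q)"
  \<comment> \<open>If \<open>x + y = 0\<close> then \<open>k = 0\<close>, so one cannot divide by
    \<open>k\<close>; in that case \<open>r\<close> coincides with \<open>p\<close>.\<close>
  proof (cases "x + y = 0")
    case True
    then have "x = 0" using xy by simp
    then have "(dist p r)\<^sup>2 / (2 * snd p * snd r) = 0"
      using hyp_dist_arg_ge1[OF p r] cosh_arcosh_real[OF hyp_dist_arg_ge1[OF p r]]
      by (simp add: x_def hyp_dist_def)
    then have "p = r" using p r by (simp add: hyp_space_def)
    then show ?thesis by simp
  next
    case False
    then have k: "k > 0" using xy abc by (simp add: k_def)
    \<comment> \<open>The first component of the vanishing vector gives \<open>k = l + m\<close>, so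
      \<open>l / k\<close> and \<open>m / k\<close> are convex weights.\<close>
    have lm: "l \<ge> 0" "m \<ge> 0" "k = l + m" using xy abc zero by (simp_all add: l_def m_def)
    have "paraboloid r = (1 - m / k) *\<^sub>R paraboloid p + (m / k) *\<^sub>R paraboloid q"
    proof (rule prod_eqI)
      have "1 - m / k = l / k" using k lm by (simp add: field_simps)
      moreover have "zr = (l / k) *\<^sub>R zp + (m / k) *\<^sub>R zq"
      proof -
        have "zr = (1 / k) *\<^sub>R (k *\<^sub>R zr)" using k by simp
        also have "k *\<^sub>R zr = l *\<^sub>R zp + m *\<^sub>R zq" using zero(3) by (simp add: algebra_simps)
        finally show ?thesis by (simp add: scaleR_add_right)
      qed
      ultimately show "fst (paraboloid r) = fst ((1 - m / k) *\<^sub>R paraboloid p + (m / k) *\<^sub>R paraboloid q)"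
        by (simp add: paraboloid_def zp_def zq_def zr_def)
      have "k * hr = l * hp + m * hq" using zero(2) by simp
      then have "hr = (l / k) * hp + (m / k) * hq" using k by (simp add: field_simps)
      then show "snd (paraboloid r) = snd ((1 - m / k) *\<^sub>R paraboloid p + (m / k) *\<^sub>R paraboloid q)"
        using \<open>1 - m / k = l / k\<close> by (simp add: paraboloid_def hp_def hq_def hr_def)
    qed
    moreover have "0 \<le> m / k" "m / k \<le> 1" using k lm by auto
    ultimately show ?thesis by (auto simp: in_segment)
  qed
qed

section \<open>Convexity in the paraboloid model\<close>

text \<open>The last term is the gap between the paraboloid and its chord. Its sign gives convexity
  in \<open>convex_paraboloid_image\<close>, and its size gives the height of the cylinders in
  \<open>cylinder_subset_CH\<close>.\<close>

lemma norm_convex_comb_sq: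
  fixes a b :: "'a::real_inner"
  shows "(norm ((1 - \<tau>) *\<^sub>R a + \<tau> *\<^sub>R b))\<^sup>2
    = (1 - \<tau>) * (norm a)\<^sup>2 + \<tau> * (norm b)\<^sup>2 - \<tau> * (1 - \<tau>) * (norm (a - b))\<^sup>2"
  unfolding power2_norm_eq_inner
  by (simp add: inner_add_left inner_add_right inner_diff_left inner_diff_right inner_commute algebra_simps)

text \<open>The inverse of \<open>paraboloid\<close> on the region strictly above the surface
  \<open>h = |z|^2\<close>.\<close>

definition unparaboloid :: "complex \<times> real \<Rightarrow> complex \<times> real" where
  "unparaboloid x = (fst x, sqrt (snd x - (norm (fst x))\<^sup>2))"

lemma paraboloid_unparaboloid:
  assumes "(norm (fst x))\<^sup>2 < snd x"
  shows "unparaboloid x \<in> hyp_space" "paraboloid (unparaboloid x) = x"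
  using assms order_le_less_trans[OF zero_le_power2 assms]
  by (auto simp: unparaboloid_def hyp_space_def paraboloid_def norm_Pair prod_eq_iff)

lemma unparaboloid_paraboloid: "p \<in> hyp_space \<Longrightarrow> unparaboloid (paraboloid p) = p"
  by (simp add: unparaboloid_def hyp_space_def paraboloid_def norm_prod_sq prod_eq_iff)

lemma paraboloid_above: "p \<in> hyp_space \<Longrightarrow> (norm (fst (paraboloid p)))\<^sup>2 < snd (paraboloid p)"
  by (simp add: paraboloid_def hyp_space_def norm_prod_sq)

text \<open>Since \<open>|z|^2\<close> is convex, a chord between points above the surface stays
  above it. Each of its points therefore comes from the half-space, and
  \<open>hyp_segment_iff\<close> puts that preimage on the hyperbolic segment.\<close>

lemma convex_paraboloid_image:
  assumes "hyp_convex S"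
  shows "convex (paraboloid ` S)"
  unfolding convex_contains_segment
proof (intro ballI)
  fix x y assume "x \<in> paraboloid ` S" "y \<in> paraboloid ` S"
  then obtain p q where pq: "p \<in> S" "q \<in> S" and xy: "x = paraboloid p" "y = paraboloid q" by auto
  then have h: "p \<in> hyp_space" "q \<in> hyp_space" using assms by (auto simp: hyp_convex_def)
  show "closed_segment x y \<subseteq> paraboloid ` S"
  proof
    fix w assume w: "w \<in> closed_segment x y"
    then obtain \<tau> where \<tau>: "0 \<le> \<tau>" "\<tau> \<le> 1" and weq: "w = (1 - \<tau>) *\<^sub>R x + \<tau> *\<^sub>R y"
      by (auto simp: in_segment)
    have "(norm (fst w))\<^sup>2 \<le> (1 - \<tau>) * (norm (fst x))\<^sup>2 + \<tau> * (norm (fst y))\<^sup>2"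
      using \<tau> by (simp add: weq norm_convex_comb_sq)
    also have "\<dots> < (1 - \<tau>) * snd x + \<tau> * snd y"
    \<comment> \<open>At least one weight is positive, and the endpoint carrying it makes the
      inequality strict.\<close>
    proof (cases "\<tau> = 0")
      case False
      then have "\<tau> * (norm (fst y))\<^sup>2 < \<tau> * snd y"
        using \<tau> paraboloid_above[OF h(2)] by (simp add: xy)
      moreover have "(1 - \<tau>) * (norm (fst x))\<^sup>2 \<le> (1 - \<tau>) * snd x"
        using \<tau> paraboloid_above[OF h(1)] by (simp add: xy mult_left_mono)
      ultimately show ?thesis by linarith
    qed (use paraboloid_above[OF h(1)] xy in simp)
    also have "\<dots> = snd w" by (simp add: weq)
    finally have "(norm (fst w))\<^sup>2 < snd w" .
    note r = paraboloid_unparaboloid[OF this]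
    then have "unparaboloid w \<in> hyp_segment p q"
      using hyp_segment_iff[OF h r(1)] w xy by simp
    then have "unparaboloid w \<in> S" using assms pq by (auto simp: hyp_convex_def)
    then show "w \<in> paraboloid ` S" using r(2) by force
  qed
qed

section \<open>The hull in the paraboloid model\<close>

text \<open>Intersections preserve closure under segments; the inclusion in \<open>hyp_space\<close>
  holds because \<open>hyp_space\<close> is itself a member of the intersected family.\<close>

lemma hyp_convex_CH: "hyp_convex (CH E)"
proof -
  let ?G = "\<Union>{range \<gamma> | \<gamma>. hyp_geodesic \<gamma> \<and>
          (\<exists>\<zeta>\<in>E. tends_to_ideal \<gamma> \<zeta> at_bot) \<and> (\<exists>\<zeta>\<in>E. tends_to_ideal \<gamma> \<zeta> at_top)}"
  have "hyp_convex hyp_space" by (auto simp: hyp_convex_def hyp_segment_def)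
  moreover have "?G \<subseteq> hyp_space" by (auto simp: hyp_geodesic_def)
  ultimately have "CH E \<subseteq> hyp_space" unfolding CH_def by (intro hull_minimal)
  moreover have "hyp_segment p q \<subseteq> CH E" if "p \<in> CH E" "q \<in> CH E" for p q
  proof
    fix r assume r: "r \<in> hyp_segment p q"
    show "r \<in> CH E"
      unfolding CH_def hull_def
    proof (rule InterI)
      fix T assume "T \<in> {t. hyp_convex t \<and> ?G \<subseteq> t}"
      then have "hyp_convex T" "CH E \<subseteq> T" unfolding CH_def by (simp_all add: hull_minimal)
      then show "r \<in> T" using that r unfolding hyp_convex_def by blast
    qed
  qed
  ultimately show ?thesis by (auto simp: hyp_convex_def)
qed

lemma geodesic_subset_CH:
  assumes "hyp_geodesic \<gamma>" "\<zeta> \<in> E" "tends_to_ideal \<gamma> \<zeta> at_bot" "\<zeta>' \<in> E" "tends_to_ideal \<gamma> \<zeta>' at_top"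
  shows "\<gamma> s \<in> CH E"
proof -
  have "\<gamma> s \<in> \<Union>{range \<gamma> | \<gamma>. hyp_geodesic \<gamma> \<and>
          (\<exists>\<zeta>\<in>E. tends_to_ideal \<gamma> \<zeta> at_bot) \<and> (\<exists>\<zeta>\<in>E. tends_to_ideal \<gamma> \<zeta> at_top)}"
    using assms by blast
  then show ?thesis unfolding CH_def by (rule hull_inc)
qed

section \<open>Geodesics with finite ends, and the lower bound for the hull\<close>

text \<open>The semicircle over the segment from \<open>m - w\<close> to \<open>m + w\<close>,
  parametrised by arc length. Since \<open>tanh^2 + 1 / cosh^2 = 1\<close>, the distance formula
  collapses to \<open>cosh (s - t)\<close>.\<close>

lemma semicircle_geodesic:
  fixes m w :: complex
  assumes "w \<noteq> 0"
  defines "\<gamma> \<equiv> \<lambda>s. (m + tanh s *\<^sub>R w, norm w / cosh s)"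
  shows "hyp_geodesic \<gamma>" "(\<gamma> \<longlongrightarrow> (m - w, 0)) at_bot" "(\<gamma> \<longlongrightarrow> (m + w, 0)) at_top"
proof -
  have H: "\<gamma> s \<in> hyp_space" for s using assms by (simp add: \<gamma>_def hyp_space_def)
  have "hyp_dist (\<gamma> s) (\<gamma> t) = \<bar>s - t\<bar>" for s t
  proof -
    have "cosh (hyp_dist (\<gamma> s) (\<gamma> t)) = 1 + (dist (\<gamma> s) (\<gamma> t))\<^sup>2 / (2 * snd (\<gamma> s) * snd (\<gamma> t))"
      unfolding hyp_dist_def using hyp_dist_arg_ge1[OF H H] by (simp only: cosh_arcosh_real)
    also have "(dist (\<gamma> s) (\<gamma> t))\<^sup>2
        = (norm w)\<^sup>2 * ((tanh s - tanh t)\<^sup>2 + (1 / cosh s - 1 / cosh t)\<^sup>2)"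
    proof -
      have 1: "dist (m + tanh s *\<^sub>R w) (m + tanh t *\<^sub>R w) = \<bar>tanh s - tanh t\<bar> * norm w"
        by (simp add: dist_norm flip: scaleR_left_diff_distrib)
      have 2: "dist (norm w / cosh s) (norm w / cosh t) = norm w * \<bar>1 / cosh s - 1 / cosh t\<bar>"
      proof -
        have "norm w / cosh s - norm w / cosh t = norm w * (1 / cosh s - 1 / cosh t)"
          by (simp add: right_diff_distrib)
        then show ?thesis by (simp only: dist_real_def abs_mult abs_norm_cancel)
      qed
      show ?thesis
        unfolding \<gamma>_def dist_Pair_Pair 1 2 by (simp add: power_mult_distrib algebra_simps)
    qed
    also have "1 + \<dots> / (2 * snd (\<gamma> s) * snd (\<gamma> t))
        = 1 + cosh s * cosh t * ((tanh s - tanh t)\<^sup>2 + (1 / cosh s - 1 / cosh t)\<^sup>2) / 2"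
      using assms(1) by (simp add: \<gamma>_def field_simps power2_eq_square)
    also have "\<dots> = cosh s * cosh t - sinh s * sinh t"
    proof -
      have sq: "(tanh x)\<^sup>2 + (1 / cosh x)\<^sup>2 = 1" for x :: real
      proof -
        have "(tanh x)\<^sup>2 + (1 / cosh x)\<^sup>2 = ((sinh x)\<^sup>2 + 1) / (cosh x)\<^sup>2"
          by (simp add: tanh_def power_divide add_divide_distrib)
        also have "(sinh x)\<^sup>2 + 1 = (cosh x)\<^sup>2" using hyperbolic_pythagoras[of x] by simp
        finally show ?thesis by simp
      qed
      have "(tanh s - tanh t)\<^sup>2 + (1 / cosh s - 1 / cosh t)\<^sup>2
          = 2 - 2 * (tanh s * tanh t) - 2 * (1 / cosh s) * (1 / cosh t)"
        using sq[of s] sq[of t] by algebra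
      then have "1 + cosh s * cosh t * ((tanh s - tanh t)\<^sup>2 + (1 / cosh s - 1 / cosh t)\<^sup>2) / 2
          = cosh s * cosh t - (cosh s * tanh s) * (cosh t * tanh t)"
        by (simp add: field_simps)
      then show ?thesis by (simp add: tanh_def)
    qed
    also have "\<dots> = cosh \<bar>s - t\<bar>" by (simp add: cosh_diff)
    finally show ?thesis
      using hyp_dist_nonneg[OF H H] by (metis arcosh_cosh_real abs_ge_zero)
  qed
  then show "hyp_geodesic \<gamma>" using H by (auto simp: hyp_geodesic_def)
  have "((\<lambda>s::real. norm w / cosh s) \<longlongrightarrow> 0) at_bot" "((\<lambda>s::real. norm w / cosh s) \<longlongrightarrow> 0) at_top"
    by (auto intro!: tendsto_divide_0[OF tendsto_const] filterlim_at_top_imp_at_infinity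
        cosh_real_at_bot cosh_real_at_top)
  moreover have "((\<lambda>s. m + tanh s *\<^sub>R w) \<longlongrightarrow> m + (-1) *\<^sub>R w) at_bot"
      "((\<lambda>s. m + tanh s *\<^sub>R w) \<longlongrightarrow> m + 1 *\<^sub>R w) at_top"
    by (intro tendsto_intros tanh_real_at_bot tanh_real_at_top)+
  ultimately show "(\<gamma> \<longlongrightarrow> (m - w, 0)) at_bot" "(\<gamma> \<longlongrightarrow> (m + w, 0)) at_top"
    unfolding \<gamma>_def by (auto intro: tendsto_Pair)
qed

lemma tendsto_paraboloid:
  assumes "(\<gamma> \<longlongrightarrow> (z, 0)) F"
  shows "((\<lambda>s. paraboloid (\<gamma> s)) \<longlongrightarrow> lift z) F"
proof -
  have "((\<lambda>s. (fst (\<gamma> s), (norm (\<gamma> s))\<^sup>2)) \<longlongrightarrow> (fst (z, 0::real), (norm (z, 0::real))\<^sup>2)) F"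
    by (intro tendsto_intros assms)
  then show ?thesis by (simp add: paraboloid_def lift_def norm_Pair)
qed

text \<open>The semicircle with ends \<open>p\<close> and \<open>q\<close> lies in
  \<open>CH E\<close>, and its image runs into \<open>lift p\<close> at one end.\<close>

lemma lift_in_closure:
  assumes "Some p \<in> E" "Some q \<in> E" "p \<noteq> q"
  shows "lift p \<in> closure (paraboloid ` CH E)"
proof -
  define m w where "m = (p + q) / 2" and "w = (q - p) / 2"
  have pq: "m - w = p" "m + w = q" by (simp_all add: m_def w_def field_simps)
  have "w \<noteq> 0" using assms by (simp add: w_def)
  note \<gamma> = semicircle_geodesic[OF this, of m, unfolded pq]
  define \<gamma> where "\<gamma> = (\<lambda>s. (m + tanh s *\<^sub>R w, norm w / cosh s))"
  have "\<gamma> s \<in> CH E" for s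
    using \<gamma> assms unfolding \<gamma>_def by (intro geodesic_subset_CH[where \<zeta> = "Some p" and \<zeta>' = "Some q"])
      (auto simp: tends_to_ideal_def)
  then have "paraboloid (\<gamma> s) \<in> closure (paraboloid ` CH E)" for s
    using closure_subset by blast
  moreover have "((\<lambda>s. paraboloid (\<gamma> s)) \<longlongrightarrow> lift p) at_bot"
    using \<gamma>(2) unfolding \<gamma>_def by (rule tendsto_paraboloid)
  ultimately show ?thesis
    by (intro Lim_in_closed_set[OF closed_closure, of "\<lambda>s. paraboloid (\<gamma> s)"]) auto
qed

text \<open>Lifts are only limits of image points, but a convex set and its closure have the same
  interior.\<close>

lemma interior_hull_lift_subset:
  assumes "Some p \<in> E" "Some q \<in> E" "p \<noteq> q"
  shows "interior (convex hull (lift ` {z. Some z \<in> E})) \<subseteq> paraboloid ` CH E"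
proof -
  have cvx: "convex (paraboloid ` CH E)" by (rule convex_paraboloid_image[OF hyp_convex_CH])
  have "lift z \<in> closure (paraboloid ` CH E)" if "Some z \<in> E" for z
    using lift_in_closure[of z E p] lift_in_closure[of z E q] that assms by metis
  then have "convex hull (lift ` {z. Some z \<in> E}) \<subseteq> closure (paraboloid ` CH E)"
    using cvx by (intro hull_minimal) (auto intro: convex_closure)
  then have "interior (convex hull (lift ` {z. Some z \<in> E})) \<subseteq> interior (closure (paraboloid ` CH E))"
    by (rule interior_mono)
  then show ?thesis using convex_interior_closure[OF cvx] interior_subset by blast
qed

section \<open>Hulls over plane sections\<close>

text \<open>Dividing by \<open>1 + h\<close> makes the defect of a plane equation tend to \<open>0\<close> also at the end \<open>\<infinity>\<close>,
  and keeps it controlled along a chord by its values at the endpoints.\<close>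

lemma geodesic_end_plane:
  fixes \<beta> :: complex and \<alpha> b :: real
  assumes lim_end: "tends_to_ideal \<gamma> \<zeta> F"
    and fin: "\<And>z. \<zeta> = Some z \<Longrightarrow> (\<beta>, \<alpha>) \<bullet> lift z = b" and inf: "\<zeta> = None \<Longrightarrow> \<alpha> = 0"
  shows "((\<lambda>s. ((\<beta>, \<alpha>) \<bullet> paraboloid (\<gamma> s) - b) / (1 + (norm (\<gamma> s))\<^sup>2)) \<longlongrightarrow> 0) F"
proof (cases \<zeta>)
  case (Some z)
  then have lim: "(\<gamma> \<longlongrightarrow> (z, 0)) F" using lim_end by (simp add: tends_to_ideal_def)
  have "((\<lambda>s. ((\<beta>, \<alpha>) \<bullet> paraboloid (\<gamma> s) - b) / (1 + (norm (\<gamma> s))\<^sup>2)) \<longlongrightarrow>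
      ((\<beta>, \<alpha>) \<bullet> lift z - b) / (1 + (norm (z, 0::real))\<^sup>2)) F"
    by (intro tendsto_intros tendsto_paraboloid lim) (simp add: add_nonneg_eq_0_iff)
  then show ?thesis using fin[OF Some] by simp
next
  case None
  then have lim: "filterlim \<gamma> at_infinity F" and "\<alpha> = 0" using lim_end inf by (auto simp: tends_to_ideal_def)
  \<comment> \<open>With \<alpha> = 0 the defect grows at most linearly in the norm, while the
    denominator grows quadratically.\<close>
  have "filterlim (\<lambda>s. norm (\<gamma> s)) at_top F"
    using lim by (simp add: filterlim_at_infinity_conv_norm_at_top)
  then have ev: "eventually (\<lambda>s. norm (\<gamma> s) \<ge> 1) F"
    and lim0: "((\<lambda>s. (norm \<beta> + \<bar>b\<bar>) / norm (\<gamma> s)) \<longlongrightarrow> 0) F"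
    by (auto simp: filterlim_at_top intro!: tendsto_divide_0[OF tendsto_const] filterlim_at_top_imp_at_infinity)
  show ?thesis
  proof (rule Lim_null_comparison[OF _ lim0])
    show "eventually (\<lambda>s. norm (((\<beta>, \<alpha>) \<bullet> paraboloid (\<gamma> s) - b) / (1 + (norm (\<gamma> s))\<^sup>2))
        \<le> (norm \<beta> + \<bar>b\<bar>) / norm (\<gamma> s)) F"
      using ev
    proof eventually_elim
      case (elim s)
      let ?n = "norm (\<gamma> s)"
      have "\<bar>\<beta> \<bullet> fst (\<gamma> s)\<bar> \<le> norm \<beta> * norm (fst (\<gamma> s))" by (rule Cauchy_Schwarz_ineq2)
      also have "\<dots> \<le> norm \<beta> * ?n" using norm_fst_le[of "fst (\<gamma> s)" "snd (\<gamma> s)"] by (simp add: mult_left_mono)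
      finally have "\<bar>(\<beta>, \<alpha>) \<bullet> paraboloid (\<gamma> s) - b\<bar> \<le> norm \<beta> * ?n + \<bar>b\<bar>"
        using \<open>\<alpha> = 0\<close> by (simp add: paraboloid_def inner_prod_def)
      also have "\<dots> \<le> (norm \<beta> + \<bar>b\<bar>) * ?n"
        using elim mult_left_mono[of 1 ?n "\<bar>b\<bar>"] by (simp add: distrib_right)
      finally have "\<bar>(\<beta>, \<alpha>) \<bullet> paraboloid (\<gamma> s) - b\<bar> \<le> (norm \<beta> + \<bar>b\<bar>) * ?n" .
      then have "\<bar>(\<beta>, \<alpha>) \<bullet> paraboloid (\<gamma> s) - b\<bar> / (1 + ?n\<^sup>2) \<le> (norm \<beta> + \<bar>b\<bar>) * ?n / ?n\<^sup>2"
        using elim by (intro frac_le) auto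
      moreover have "(norm \<beta> + \<bar>b\<bar>) * ?n / ?n\<^sup>2 = (norm \<beta> + \<bar>b\<bar>) / ?n"
        using elim by (simp add: power2_eq_square)
      moreover have "1 + ?n\<^sup>2 > 0" by (simp add: add_pos_nonneg)
      ultimately show ?case by (simp only: real_norm_def abs_divide abs_of_pos)
    qed
  qed
qed

text \<open>The preimage of a plane is hyperbolically convex, so it suffices to treat the generating
  geodesics. There the defect ratio at any time is bounded by its values near the two ends, where it
  tends to 0.\<close>

lemma CH_subset_plane:
  fixes \<beta> :: complex and \<alpha> b :: real
  assumes fin: "\<And>z. Some z \<in> K \<Longrightarrow> (\<beta>, \<alpha>) \<bullet> lift z = b" and inf: "None \<in> K \<Longrightarrow> \<alpha> = 0"
  shows "CH K \<subseteq> {p. (\<beta>, \<alpha>) \<bullet> paraboloid p = b}"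
proof -
  let ?S = "{p \<in> hyp_space. (\<beta>, \<alpha>) \<bullet> paraboloid p = b}"
  have "hyp_convex ?S"
    unfolding hyp_convex_def
  proof (intro conjI ballI subsetI)
    fix p q r assume pq: "p \<in> ?S" "q \<in> ?S" and r: "r \<in> hyp_segment p q"
    then have "r \<in> hyp_space" by (simp add: hyp_segment_def)
    then have "paraboloid r \<in> closed_segment (paraboloid p) (paraboloid q)"
      using hyp_segment_iff pq r by blast
    also have "\<dots> \<subseteq> {x. (\<beta>, \<alpha>) \<bullet> x = b}"
      using pq by (intro closed_segment_subset convex_hyperplane) auto
    finally show "r \<in> ?S" using \<open>r \<in> hyp_space\<close> by simp
  qed auto
  moreover have "\<gamma> t \<in> ?S"
    if geo: "hyp_geodesic \<gamma>" and "\<zeta> \<in> K" "tends_to_ideal \<gamma> \<zeta> at_bot" "\<zeta>' \<in> K" "tends_to_ideal \<gamma> \<zeta>' at_top"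
    for \<gamma> \<zeta> \<zeta>' t
  proof -
    have H: "\<gamma> s \<in> hyp_space" for s using geo by (auto simp: hyp_geodesic_def)
    define \<phi> h where "\<phi> = (\<lambda>s. (\<beta>, \<alpha>) \<bullet> paraboloid (\<gamma> s) - b)" and "h = (\<lambda>s. 1 + (norm (\<gamma> s))\<^sup>2)"
    have h: "h s > 0" for s by (simp add: h_def add_pos_nonneg)
    have bot: "((\<lambda>s. \<phi> s / h s) \<longlongrightarrow> 0) at_bot" and top: "((\<lambda>s. \<phi> s / h s) \<longlongrightarrow> 0) at_top"
      unfolding \<phi>_def h_def using that fin inf by (auto intro!: geodesic_end_plane)
    have "\<bar>\<phi> t / h t\<bar> \<le> e" if "e > 0" for e
    proof -
      have "eventually (\<lambda>s. \<bar>\<phi> s / h s\<bar> < e \<and> s \<le> t) at_bot"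
        using order_tendstoD(2)[OF tendsto_rabs_zero[OF bot] \<open>e > 0\<close>]
        by (intro eventually_conj eventually_le_at_bot)
      then obtain s where s: "\<bar>\<phi> s / h s\<bar> < e" "s \<le> t" using eventually_happens'[OF trivial_limit_at_bot_linorder] by fastforce
      have "eventually (\<lambda>s. \<bar>\<phi> s / h s\<bar> < e \<and> t \<le> s) at_top"
        using order_tendstoD(2)[OF tendsto_rabs_zero[OF top] \<open>e > 0\<close>]
        by (intro eventually_conj eventually_ge_at_top)
      then obtain u where u: "\<bar>\<phi> u / h u\<bar> < e" "t \<le> u" using eventually_happens'[OF trivial_limit_at_top_linorder] by fastforce
      have "\<gamma> t \<in> hyp_segment (\<gamma> s) (\<gamma> u)"
        using s u geo H by (simp add: hyp_segment_def hyp_geodesic_def)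
      then have "paraboloid (\<gamma> t) \<in> closed_segment (paraboloid (\<gamma> s)) (paraboloid (\<gamma> u))"
        using hyp_segment_iff H by blast
      then obtain \<tau> where \<tau>: "0 \<le> \<tau>" "\<tau> \<le> 1"
        and eq: "paraboloid (\<gamma> t) = (1 - \<tau>) *\<^sub>R paraboloid (\<gamma> s) + \<tau> *\<^sub>R paraboloid (\<gamma> u)"
        by (auto simp: in_segment)
      \<comment> \<open>Both \<phi> and \<open>h\<close> are affine in the paraboloid coordinates,
        so they interpolate with the same weight and a bound on their ratio carries over from the
        endpoints.\<close>
      have \<phi>t: "\<phi> t = (1 - \<tau>) * \<phi> s + \<tau> * \<phi> u"
        unfolding \<phi>_def eq inner_add_right inner_scaleR_right by (simp add: algebra_simps)
      have "snd (paraboloid (\<gamma> t)) = (1 - \<tau>) * snd (paraboloid (\<gamma> s)) + \<tau> * snd (paraboloid (\<gamma> u))"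
        by (simp add: eq)
      then have ht: "h t = (1 - \<tau>) * h s + \<tau> * h u"
        unfolding h_def by (simp add: paraboloid_def algebra_simps)
      have "\<bar>\<phi> s\<bar> \<le> e * h s" "\<bar>\<phi> u\<bar> \<le> e * h u"
        using s u h[of s] h[of u] by (simp_all add: abs_divide pos_divide_less_eq)
      then have "(1 - \<tau>) * \<bar>\<phi> s\<bar> + \<tau> * \<bar>\<phi> u\<bar> \<le> (1 - \<tau>) * (e * h s) + \<tau> * (e * h u)"
        using \<tau> by (intro add_mono mult_left_mono) auto
      moreover have "\<bar>\<phi> t\<bar> \<le> (1 - \<tau>) * \<bar>\<phi> s\<bar> + \<tau> * \<bar>\<phi> u\<bar>"
        unfolding \<phi>t using \<tau> abs_triangle_ineq[of "(1 - \<tau>) * \<phi> s" "\<tau> * \<phi> u"] by (simp add: abs_mult)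
      ultimately have "\<bar>\<phi> t\<bar> \<le> e * h t" unfolding ht by (simp add: algebra_simps)
      then show ?thesis using h[of t] by (simp add: abs_divide pos_divide_le_eq)
    qed
    then have "\<bar>\<phi> t / h t\<bar> \<le> 0" by (rule field_le_epsilon) simp
    then have "\<phi> t / h t = 0" by (simp only: abs_le_zero_iff)
    then have "\<phi> t = 0" using h[of t] by simp
    then show ?thesis using H by (simp add: \<phi>_def)
  qed
  ultimately have "CH K \<subseteq> ?S"
    unfolding CH_def by (intro hull_minimal) auto
  then show ?thesis by auto
qed

text \<open>The preimage is a vertical plane if \<alpha> = 0. Otherwise it lies in a Euclidean
  sphere centred at height 0, whose centre \<open>c\<close> and squared radius \<open>k\<close> come
  from completing the square.\<close>

lemma negligible_plane:
  fixes \<beta> :: complex and \<alpha> b :: real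
  assumes "(\<beta>, \<alpha>) \<noteq> 0"
  shows "negligible {p. (\<beta>, \<alpha>) \<bullet> paraboloid p = b}"
proof (cases "\<alpha> = 0")
  case True
  then have "{p. (\<beta>, \<alpha>) \<bullet> paraboloid p = b} = {p. (\<beta>, 0::real) \<bullet> p = b}"
    by (auto simp: paraboloid_def inner_prod_def)
  then show ?thesis using assms True by (simp add: negligible_hyperplane)
next
  case False
  define c where "c = (- (1 / (2 * \<alpha>)) *\<^sub>R \<beta>, 0::real)"
  define k where "k = b / \<alpha> + (norm \<beta>)\<^sup>2 / (4 * \<alpha>\<^sup>2)"
  have "p \<in> sphere c (sqrt k)" if "(\<beta>, \<alpha>) \<bullet> paraboloid p = b" for p
  proof -
    have "(dist c p)\<^sup>2 = (norm c)\<^sup>2 + (norm p)\<^sup>2 - 2 * (c \<bullet> p)"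
      by (simp add: dist_norm power2_norm_eq_inner inner_diff_left inner_diff_right inner_commute)
    also have "c \<bullet> p = - (\<beta> \<bullet> fst p) / (2 * \<alpha>)"
      by (simp add: c_def inner_prod_def)
    also have "(norm c)\<^sup>2 = (norm \<beta>)\<^sup>2 / (4 * \<alpha>\<^sup>2)"
      by (simp add: c_def norm_Pair power_divide power_mult_distrib)
    also have "\<beta> \<bullet> fst p = b - \<alpha> * (norm p)\<^sup>2"
      using that by (simp add: paraboloid_def inner_prod_def)
    finally have "(dist c p)\<^sup>2 = k" using False by (simp add: k_def field_simps)
    then have "dist c p = sqrt k" by (metis real_sqrt_unique zero_le_dist)
    then show ?thesis by simp
  qed
  then show ?thesis by (intro negligible_subset[OF negligible_sphere[of c "sqrt k"]] subsetI) blast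
qed

text \<open>Expanding \<open>|z - c|^2 = r^2\<close> gives \<alpha> = 1. A line has normal
  \<open>\<i> * v\<close> and \<alpha> = 0, and only lines contain \<open>None\<close>.\<close>

lemma sphere_circle_plane:
  assumes "sphere_circle C"
  obtains \<beta> :: complex and \<alpha> b :: real where "(\<beta>, \<alpha>) \<noteq> 0"
    "\<And>z. Some z \<in> C \<Longrightarrow> (\<beta>, \<alpha>) \<bullet> lift z = b" "None \<in> C \<Longrightarrow> \<alpha> = 0"
  using assms unfolding sphere_circle_def
proof (elim disjE exE conjE)
  fix c r assume C: "C = Some ` sphere c r"
  have "(- 2 *\<^sub>R c, 1) \<bullet> lift z = r\<^sup>2 - (norm c)\<^sup>2" if "Some z \<in> C" for z
  proof -
    have "r\<^sup>2 = (norm (c - z))\<^sup>2" using that C by (auto simp: dist_norm)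
    then show ?thesis
      by (simp add: lift_def power2_norm_eq_inner inner_diff_left inner_diff_right inner_commute)
  qed
  then show thesis using C by (intro that[of "- 2 *\<^sub>R c" 1]) (auto simp: zero_prod_def)
next
  fix a v :: complex assume v: "v \<noteq> 0" and C: "C = insert None (Some ` range (\<lambda>t::real. a + of_real t * v))"
  have "(\<i> * v, 0::real) \<bullet> lift z = (\<i> * v) \<bullet> a" if "Some z \<in> C" for z
    using that C by (auto simp: lift_def inner_complex_def algebra_simps)
  then show thesis using v by (intro that[of "\<i> * v" 0]) (auto simp: zero_prod_def)
qed

section \<open>Hyperbolic volume\<close>

lemma hyp_density_measurable:
  "(\<lambda>p. ennreal (1 / snd p ^ 3) * indicator hyp_space p) \<in> borel_measurable lebesgue"
proof -
  have "open hyp_space" unfolding hyp_space_def by (intro open_Collect_less continuous_intros)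
  then have [measurable]: "hyp_space \<in> sets borel" by simp
  have "(\<lambda>p::complex \<times> real. ennreal (1 / snd p ^ 3) * indicator hyp_space p) \<in> borel_measurable borel"
    unfolding borel_prod[symmetric] by measurable (simp add: borel_prod)
  then show ?thesis by (intro measurable_completion) simp
qed

lemma hyp_volume_negligible:
  assumes "negligible N"
  shows "emeasure hyp_volume N = 0"
proof -
  have N: "N \<in> null_sets lebesgue" using assms by (simp add: negligible_iff_null_sets)
  then show ?thesis
    unfolding hyp_volume_def using hyp_density_measurable
    by (subst emeasure_density) (auto intro: nn_integral_null_set)
qed

lemma hyp_volume_ge:
  assumes X: "X \<in> sets lebesgue" and T: "\<And>p. p \<in> X \<Longrightarrow> 0 < snd p \<and> snd p \<le> T"
  shows "ennreal (1 / T ^ 3) * emeasure lebesgue X \<le> emeasure hyp_volume X"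
proof -
  have "ennreal (1 / T ^ 3) * emeasure lebesgue X = (\<integral>\<^sup>+p. ennreal (1 / T ^ 3) * indicator X p \<partial>lebesgue)"
    using X by (simp add: nn_integral_cmult_indicator)
  also have "\<dots> \<le> (\<integral>\<^sup>+p. ennreal (1 / snd p ^ 3) * indicator hyp_space p * indicator X p \<partial>lebesgue)"
  proof (rule nn_integral_mono)
    fix p
    show "ennreal (1 / T ^ 3) * indicator X p \<le> ennreal (1 / snd p ^ 3) * indicator hyp_space p * indicator X p"
      using T[of p] by (auto simp: indicator_def hyp_space_def intro!: ennreal_leI frac_le power_mono zero_less_power)
  qed
  also have "\<dots> = emeasure hyp_volume X"
    unfolding hyp_volume_def using X hyp_density_measurable by (simp add: emeasure_density)
  finally show ?thesis .
qed

lemma emeasure_lebesgue_cylinder: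
  fixes z :: complex and t :: real
  assumes "r \<ge> 0" "s \<ge> 0"
  shows "emeasure lebesgue (ball z r \<times> ball t s) = ennreal (pi * r\<^sup>2 * (2 * s))"
proof -
  have "emeasure lebesgue (ball z r \<times> ball t s) = emeasure lborel (ball z r \<times> ball t s)"
    by (simp add: open_Times)
  also have "\<dots> = emeasure (lborel \<Otimes>\<^sub>M lborel) (ball z r \<times> ball t s)"
    by (simp add: lborel_prod)
  also have "\<dots> = emeasure lborel (ball z r) * emeasure lborel (ball t s)"
    by (rule lborel.emeasure_pair_measure_Times) auto
  also have "emeasure lborel (ball z r) = ennreal (pi * r\<^sup>2)"
    using assms by (simp add: emeasure_ball unit_ball_vol_2)
  also have "emeasure lborel (ball t s) = ennreal (2 * s)"
    using assms by (simp add: emeasure_ball)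
  finally show ?thesis using assms by (simp add: ennreal_mult)
qed

text \<open>A convex set differs from its interior by a negligible set, and the smooth inverse map
  preserves negligibility; so \<open>CH E\<close> is an open set together with a negligible one.
  Without measurability \<open>emeasure\<close> would return its default value 0.\<close>

lemma sets_lebesgue_CH: "CH E \<in> sets lebesgue"
proof -
  define S where "S = paraboloid ` CH E"
  have H: "CH E \<subseteq> hyp_space" using hyp_convex_CH by (simp add: hyp_convex_def)
  have above: "(norm (fst x))\<^sup>2 < snd x" if "x \<in> S" for x
    using that H paraboloid_above by (auto simp: S_def)
  have inv: "p \<in> CH E \<longleftrightarrow> paraboloid p \<in> S" if "p \<in> hyp_space" for p
    using that H unfolding S_def by (metis image_iff subsetD unparaboloid_paraboloid)
  have "convex S" unfolding S_def by (rule convex_paraboloid_image[OF hyp_convex_CH])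
  have "negligible (S - interior S)"
    by (rule negligible_subset[OF negligible_convex_frontier[OF \<open>convex S\<close>]])
      (use closure_subset in \<open>auto simp: frontier_def\<close>)
  moreover have "unparaboloid differentiable_on (S - interior S)"
    unfolding differentiable_on_def
  proof
    fix x assume "x \<in> S - interior S"
    \<comment> \<open>The root is smooth where its argument is positive; writing
      \<open>|z|^2\<close> as an inner product avoids differentiating \<open>norm\<close> at
      0.\<close>
    then have "snd x - fst x \<bullet> fst x > 0" using above by (simp add: power2_norm_eq_inner)
    then have "(\<lambda>x. (fst x, sqrt (snd x - fst x \<bullet> fst x))) differentiable at x"
      unfolding differentiable_def by (auto intro!: exI derivative_eq_intros)
    then show "unparaboloid differentiable at x within S - interior S"
      unfolding unparaboloid_def power2_norm_eq_inner by (rule differentiable_at_withinI)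
  qed
  ultimately have "negligible (unparaboloid ` (S - interior S))"
    by (intro negligible_differentiable_image_negligible) auto
  moreover have "open (hyp_space \<inter> paraboloid -` interior S)"
    unfolding hyp_space_def paraboloid_def
    by (intro open_Int open_Collect_less open_vimage open_interior continuous_intros)
  moreover have "CH E = (hyp_space \<inter> paraboloid -` interior S) \<union> unparaboloid ` (S - interior S)"
  proof (intro equalityI subsetI)
    fix p assume p: "p \<in> CH E"
    then have "p \<in> hyp_space" "paraboloid p \<in> S" using H by (auto simp: S_def)
    then show "p \<in> (hyp_space \<inter> paraboloid -` interior S) \<union> unparaboloid ` (S - interior S)"
      using unparaboloid_paraboloid[of p] by (cases "paraboloid p \<in> interior S") force+
  next
    fix p assume "p \<in> (hyp_space \<inter> paraboloid -` interior S) \<union> unparaboloid ` (S - interior S)"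
    then show "p \<in> CH E"
    proof
      assume "p \<in> hyp_space \<inter> paraboloid -` interior S"
      then show ?thesis using inv interior_subset by blast
    next
      assume "p \<in> unparaboloid ` (S - interior S)"
      then obtain x where "x \<in> S" "p = unparaboloid x" by auto
      then show ?thesis using inv paraboloid_unparaboloid[OF above] by metis
    qed
  qed
  ultimately show ?thesis
    by (metis negligible_imp_sets sets.Un lborelD sets_completionI_sets sets_lborel borel_open)
qed

section \<open>Continua outside circles\<close>

text \<open>Otherwise the open disc and the exterior, which includes \<open>None\<close>, would
  disconnect \<open>K\<close>. The condition on \<zeta> is vacuous for \<open>None\<close>, so
  \<infinity> counts as outside every circle.\<close>

lemma continuum_crosses_circle:
  assumes "continuum K" and z: "Some z \<in> K" "norm (z - c) < \<sigma>"
    and \<zeta>: "\<zeta> \<in> K" "\<And>w. \<zeta> = Some w \<Longrightarrow> norm (w - c) > \<sigma>"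
  obtains w where "Some w \<in> K" "norm (w - c) = \<sigma>"
proof (rule ccontr)
  assume "\<not> thesis"
  with that have no: "\<And>w. Some w \<in> K \<Longrightarrow> norm (w - c) \<noteq> \<sigma>" by blast
  define U V where "U = Some ` ball c \<sigma>" and "V = insert None (Some ` (- cball c \<sigma>))"
  have "openin riemann_sphere U"
    unfolding riemann_sphere_def openin_Alexandroff_compactification U_def
    by (intro disjI1 exI[of _ "ball c \<sigma>"]) simp
  moreover have "openin riemann_sphere V"
    unfolding riemann_sphere_def openin_Alexandroff_compactification V_def
    by (intro disjI2 exI[of _ "cball c \<sigma>"]) (simp add: Compl_eq_Diff_UNIV)
  moreover have "K \<subseteq> U \<union> V"
  proof
    fix x assume "x \<in> K"
    then show "x \<in> U \<union> V"
      using no by (cases x) (auto simp: U_def V_def dist_norm norm_minus_commute image_iff)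
  qed
  moreover have "U \<inter> V \<inter> K = {}" by (auto simp: U_def V_def)
  moreover have "Some z \<in> U" using z by (simp add: U_def dist_norm norm_minus_commute)
  then have "U \<inter> K \<noteq> {}" using z by blast
  moreover have "V \<inter> K \<noteq> {}"
  proof -
    have "\<zeta> \<in> V" using \<zeta>(2) by (cases \<zeta>) (auto simp: V_def dist_norm norm_minus_commute image_iff)
    then show ?thesis using \<zeta>(1) by auto
  qed
  ultimately show False using assms(1) unfolding continuum_def connectedin by blast
qed

text \<open>A flat hull lies in a plane, whose equation on the finite points of \<open>K\<close>
  describes a line or a round circle according to whether \<alpha> vanishes.\<close>

lemma sphere_circle_if_flat:
  assumes K: "continuum K" and flat: "interior (convex hull (lift ` {z. Some z \<in> K})) = {}"
  shows "\<exists>C. sphere_circle C \<and> K \<subseteq> C"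
proof -
  have line: "sphere_circle (insert None (Some ` range (\<lambda>t::real. a + of_real t * v)))" if "v \<noteq> 0" for a v
    using that unfolding sphere_circle_def by blast
  \<comment> \<open>If \<open>K\<close> has at most one finite point, a line through
    \<open>c\<close> contains it, and also \<open>None\<close>.\<close>
  have point: ?thesis if "\<And>z. Some z \<in> K \<Longrightarrow> z = c" for c
  proof -
    have "x \<in> insert None (Some ` range (\<lambda>t::real. c + of_real t * 1))" if "x \<in> K" for x
      using that \<open>\<And>z. Some z \<in> K \<Longrightarrow> z = c\<close> by (cases x) (auto simp: image_iff intro!: exI[of _ 0])
    then show ?thesis using line[of 1 c] by auto
  qed
  obtain w b where "w \<noteq> 0" and w: "convex hull (lift ` {z. Some z \<in> K}) \<subseteq> {x. w \<bullet> x = b}"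
    using empty_interior_subset_hyperplane[OF convex_convex_hull flat] by blast
  obtain \<beta> \<alpha> where \<beta>\<alpha>: "w = (\<beta>, \<alpha>)" by (cases w)
  have plane: "\<beta> \<bullet> z + \<alpha> * (norm z)\<^sup>2 = b" if "Some z \<in> K" for z
  proof -
    have "lift z \<in> convex hull (lift ` {z. Some z \<in> K})" using that by (simp add: hull_inc)
    then have "(\<beta>, \<alpha>) \<bullet> lift z = b" using w \<beta>\<alpha> by blast
    then show ?thesis by (simp add: lift_def)
  qed
  show ?thesis
  proof (cases "\<alpha> = 0")
    case True
    then have "\<beta> \<noteq> 0" using \<open>w \<noteq> 0\<close> \<beta>\<alpha> by (auto simp: zero_prod_def)
    define n where "n = (norm \<beta>)\<^sup>2"
    have "n > 0" using \<open>\<beta> \<noteq> 0\<close> by (simp add: n_def)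
    \<comment> \<open>Expansion in the orthogonal basis \<beta>, \<open>\<i> * \<beta>\<close>; the
      plane equation fixes the first coefficient.\<close>
    have "z = of_real (b / n) * \<beta> + of_real (z \<bullet> (\<i> * \<beta>) / n) * (\<i> * \<beta>)" if "Some z \<in> K" for z
    proof -
      have "of_real n * z = of_real (\<beta> \<bullet> z) * \<beta> + of_real (z \<bullet> (\<i> * \<beta>)) * (\<i> * \<beta>)"
        unfolding n_def cmod_power2
        by (simp add: complex_eq_iff inner_complex_def power2_eq_square algebra_simps)
      then show ?thesis
        using plane[OF that] True \<open>n > 0\<close> by (simp add: field_simps)
    qed
    then have "x \<in> insert None (Some ` range (\<lambda>t::real. of_real (b / n) * \<beta> + of_real t * (\<i> * \<beta>)))"
      if "x \<in> K" for x
      using that by (cases x) blast+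
    then show ?thesis using line[of "\<i> * \<beta>" "of_real (b / n) * \<beta>"] \<open>\<beta> \<noteq> 0\<close> by auto
  next
    case False
    define c where "c = - (1 / (2 * \<alpha>)) *\<^sub>R \<beta>"
    define k where "k = b / \<alpha> + (norm c)\<^sup>2"
    have k: "(norm (z - c))\<^sup>2 = k" if "Some z \<in> K" for z
    proof -
      have "(norm (z - c))\<^sup>2 = (norm z)\<^sup>2 + (norm c)\<^sup>2 - 2 * (c \<bullet> z)"
        by (simp add: power2_norm_eq_inner inner_diff_left inner_diff_right inner_commute)
      also have "c \<bullet> z = - (\<beta> \<bullet> z) / (2 * \<alpha>)" by (simp add: c_def)
      also have "\<beta> \<bullet> z = b - \<alpha> * (norm z)\<^sup>2" using plane[OF that] by simp
      finally show ?thesis using False by (simp add: k_def field_simps)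
    qed
    show ?thesis
    proof (cases "k > 0 \<and> (\<exists>z. Some z \<in> K)")
      case True
      define r where "r = sqrt k"
      have r: "r > 0" using True by (simp add: r_def)
      have F: "norm (z - c) = r" if "Some z \<in> K" for z
        using k[OF that] by (simp add: r_def real_sqrt_unique)
      \<comment> \<open>If \<open>None\<close> were in \<open>K\<close>, then \<open>K\<close> would
        cross the concentric circle of radius \<open>2 * r\<close>, although all its finite points
        have distance \<open>r\<close> from \<open>c\<close>.\<close>
      have "None \<notin> K"
      proof
        assume "None \<in> K"
        obtain z where "Some z \<in> K" using True by blast
        moreover from this have "norm (z - c) < 2 * r" using F r by simp
        ultimately obtain w where "Some w \<in> K" "norm (w - c) = 2 * r"
          using continuum_crosses_circle[OF K _ _ \<open>None \<in> K\<close>] by blast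
        then show False using F r by fastforce
      qed
      then have "x \<in> Some ` sphere c r" if "x \<in> K" for x
        using that F by (cases x) (auto simp: dist_norm norm_minus_commute)
      then show ?thesis using r unfolding sphere_circle_def by blast
    next
      \<comment> \<open>Either there is no finite point, or \<open>k \<le> 0\<close> forces every
        finite point to equal \<open>c\<close>.\<close>
      case nondeg: False
      have "z = c" if "Some z \<in> K" for z
        using nondeg k[OF that] that zero_less_power2[of "norm (z - c)"] by auto
      then show ?thesis by (rule point)
    qed
  qed
qed

section \<open>Cones at ideal points and infinite volume\<close>

text \<open>The homothety with centre \<open>p\<close> and ratio \<open>s\<close> maps the hull into
  itself and the given ball onto the smaller one.\<close>

lemma cone_subset_interior_hull:
  fixes S :: "'a::real_normed_vector set"
  assumes "p \<in> S" and "ball x \<rho> \<subseteq> convex hull S" and s: "0 < s" "s \<le> 1"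
  shows "ball ((1 - s) *\<^sub>R p + s *\<^sub>R x) (s * \<rho>) \<subseteq> interior (convex hull S)"
proof (rule interior_maximal[OF _ open_ball], rule subsetI)
  fix y assume y: "y \<in> ball ((1 - s) *\<^sub>R p + s *\<^sub>R x) (s * \<rho>)"
  define q where "q = (1 / s) *\<^sub>R (y - (1 - s) *\<^sub>R p)"
  have yq: "y = (1 - s) *\<^sub>R p + s *\<^sub>R q" using s by (simp add: q_def)
  have "dist ((1 - s) *\<^sub>R p + s *\<^sub>R x) y = s * dist x q"
    unfolding yq using s by (simp add: dist_norm flip: scaleR_diff_right)
  then have "q \<in> convex hull S" using y s assms(2) by auto
  then show "y \<in> convex hull S"
    unfolding yq using s assms(1) by (intro convexD[OF convex_convex_hull]) (auto intro: hull_inc)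
qed

text \<open>In paraboloid coordinates the cone over a ball with apex \<open>lift p\<close> contains a ball of radius
  comparable to \<open>s\<close> at Euclidean depth comparable to \<open>s\<close> below the boundary, that is, at height
  comparable to \<open>sqrt s\<close> in the half-space.\<close>

lemma cylinder_subset_CH:
  fixes p :: complex
  assumes cone: "ball ((1 - s) *\<^sub>R lift p + s *\<^sub>R x) (s * \<rho>) \<subseteq> paraboloid ` CH K"
    and s: "0 < s" "s \<le> 1"
    and m: "m = snd x - (norm (fst x))\<^sup>2" "m > 0"
    and M: "m + (norm (p - fst x))\<^sup>2 \<le> M"
    and R: "norm ((1 - s) *\<^sub>R p + s *\<^sub>R fst x) \<le> R"
    and \<eta>: "0 < \<eta>" "\<eta> \<le> 1" "\<eta> \<le> sqrt m / 2" "\<eta> * (4 + 2 * R + 2 * sqrt M) \<le> \<rho>"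
  shows "\<exists>t\<^sub>0. ball ((1 - s) *\<^sub>R p + s *\<^sub>R fst x) (s * \<eta>) \<times> ball t\<^sub>0 (sqrt s * \<eta>)
    \<subseteq> CH K \<inter> {q. snd q \<le> sqrt s * (sqrt M + 1)}"
proof -
  define z\<^sub>0 where "z\<^sub>0 = (1 - s) *\<^sub>R p + s *\<^sub>R fst x"
  \<comment> \<open>By \<open>norm_convex_comb_sq\<close> the centre of the ball lies
    \<open>s * d\<close> above the surface, so its height in the half-space is
    \<open>sqrt (s * d)\<close>.\<close>
  define d where "d = m + (1 - s) * (norm (p - fst x))\<^sup>2"
  define t\<^sub>0 where "t\<^sub>0 = sqrt s * sqrt d"
  have "R \<ge> 0" using R norm_ge_zero order_trans by blast
  have dm: "m \<le> d" using s by (simp add: d_def)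
  have dM: "d \<le> M"
    using M s mult_right_mono[of "1 - s" 1 "(norm (p - fst x))\<^sup>2"] by (simp add: d_def)
  have "t\<^sub>0\<^sup>2 = s * d" using s m dm by (simp add: t\<^sub>0_def power_mult_distrib)
  also have "\<dots> = (1 - s) * (norm p)\<^sup>2 + s * snd x - (norm z\<^sub>0)\<^sup>2"
    unfolding z\<^sub>0_def norm_convex_comb_sq d_def m(1) by (simp add: algebra_simps)
  finally have center: "(1 - s) *\<^sub>R lift p + s *\<^sub>R x = (z\<^sub>0, (norm z\<^sub>0)\<^sup>2 + t\<^sub>0\<^sup>2)"
    by (simp add: lift_def z\<^sub>0_def prod_eq_iff)
  have "(z, t) \<in> CH K \<inter> {q. snd q \<le> sqrt s * (sqrt M + 1)}"
    if z: "z \<in> ball z\<^sub>0 (s * \<eta>)" and t: "t \<in> ball t\<^sub>0 (sqrt s * \<eta>)" for z t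
  proof -
    have z': "norm (z - z\<^sub>0) < s * \<eta>" using z by (simp add: dist_norm norm_minus_commute)
    have t': "\<bar>t - t\<^sub>0\<bar> < sqrt s * \<eta>" using t by (simp add: dist_real_def abs_minus_commute)
    have rs: "sqrt s > 0" using s by simp
    \<comment> \<open>The vertical radius is at most half of \<open>t\<^sub>0\<close>, which keeps
      the cylinder inside the half-space.\<close>
    have "sqrt s * (2 * \<eta>) \<le> t\<^sub>0"
    proof -
      have "sqrt m \<le> sqrt d" using dm by simp
      then have "2 * \<eta> \<le> sqrt d" using \<eta>(3) by linarith
      then show ?thesis unfolding t\<^sub>0_def using rs by (intro mult_left_mono) auto
    qed
    then have "t > 0" using t' rs \<eta>(1) mult_pos_pos[OF rs \<eta>(1)] by (simp add: abs_less_iff algebra_simps)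
    have t0M: "t\<^sub>0 \<le> sqrt s * sqrt M" unfolding t\<^sub>0_def using rs dM by simp
    have "sqrt s * \<eta> \<le> sqrt s" using rs \<eta> by simp
    then have tM: "t \<le> sqrt s * (sqrt M + 1)" using t' t0M by (simp add: abs_less_iff algebra_simps)
    have "t + t\<^sub>0 \<le> sqrt s * (2 * sqrt M + 1)" using tM t0M by (simp add: algebra_simps)
    moreover have "t\<^sub>0 \<ge> 0" using s m dm by (simp add: t\<^sub>0_def)
    \<comment> \<open>Since both heights are of order \<open>sqrt s\<close>, a change of order
      \<open>sqrt s\<close> in \<open>t\<close> changes \<open>t^2\<close> only by order
      \<open>s\<close>.\<close>
    ultimately have "\<bar>t - t\<^sub>0\<bar> * (t + t\<^sub>0) \<le> (sqrt s * \<eta>) * (sqrt s * (2 * sqrt M + 1))"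
      using t' \<open>t > 0\<close> rs \<eta> by (intro mult_mono) auto
    moreover have "t\<^sup>2 - t\<^sub>0\<^sup>2 = (t - t\<^sub>0) * (t + t\<^sub>0)" by algebra
    then have "\<bar>t\<^sup>2 - t\<^sub>0\<^sup>2\<bar> = \<bar>t - t\<^sub>0\<bar> * (t + t\<^sub>0)" using \<open>t > 0\<close> \<open>t\<^sub>0 \<ge> 0\<close> by (simp add: abs_mult)
    moreover have "(sqrt s * \<eta>) * (sqrt s * (2 * sqrt M + 1)) = s * \<eta> * (2 * sqrt M + 1)"
      using s by (simp add: algebra_simps)
    ultimately have 1: "\<bar>t\<^sup>2 - t\<^sub>0\<^sup>2\<bar> \<le> s * \<eta> * (2 * sqrt M + 1)" by simp
    have dz: "\<bar>norm z - norm z\<^sub>0\<bar> \<le> s * \<eta>"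
      using z' norm_triangle_ineq3[of z z\<^sub>0] by linarith
    have "s * \<eta> \<le> 1" using s \<eta> by (simp add: mult_le_one)
    then have "norm z + norm z\<^sub>0 \<le> 2 * R + 1"
      using dz R by (simp add: z\<^sub>0_def)
    then have "\<bar>norm z - norm z\<^sub>0\<bar> * (norm z + norm z\<^sub>0) \<le> s * \<eta> * (2 * R + 1)"
      using dz s \<eta> by (intro mult_mono) auto
    moreover have "(norm z)\<^sup>2 - (norm z\<^sub>0)\<^sup>2 = (norm z - norm z\<^sub>0) * (norm z + norm z\<^sub>0)" by algebra
    then have "\<bar>(norm z)\<^sup>2 - (norm z\<^sub>0)\<^sup>2\<bar> = \<bar>norm z - norm z\<^sub>0\<bar> * (norm z + norm z\<^sub>0)"
      by (simp add: abs_mult)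
    ultimately have 2: "\<bar>(norm z)\<^sup>2 - (norm z\<^sub>0)\<^sup>2\<bar> \<le> s * \<eta> * (2 * R + 1)" by simp
    have "dist (paraboloid (z, t)) (z\<^sub>0, (norm z\<^sub>0)\<^sup>2 + t\<^sub>0\<^sup>2)
        \<le> norm (z - z\<^sub>0) + \<bar>((norm z)\<^sup>2 + t\<^sup>2) - ((norm z\<^sub>0)\<^sup>2 + t\<^sub>0\<^sup>2)\<bar>"
      using norm_Pair_le[of "z - z\<^sub>0" "((norm z)\<^sup>2 + t\<^sup>2) - ((norm z\<^sub>0)\<^sup>2 + t\<^sub>0\<^sup>2)"]
      by (simp add: paraboloid_def norm_prod_sq dist_norm)
    \<comment> \<open>The displacements of \<open>z\<close>, \<open>|z|^2\<close> and
      \<open>t^2\<close> are added; the factors of \<open>s * \<eta>\<close> sum to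
      \<open>3 + 2 * R + 2 * sqrt M\<close>, within the bound imposed on \<eta>.\<close>
    also have "\<dots> < s * \<eta> + s * \<eta> * (2 * R + 1) + s * \<eta> * (2 * sqrt M + 1)"
      using z' 1 2 by linarith
    also have "\<dots> \<le> s * (\<eta> * (4 + 2 * R + 2 * sqrt M))"
      using s \<eta> by (simp add: algebra_simps)
    also have "\<dots> \<le> s * \<rho>" using s \<eta>(4) by (intro mult_left_mono) auto
    finally have "paraboloid (z, t) \<in> paraboloid ` CH K"
      using cone unfolding center by (auto simp: dist_commute)
    then obtain q where q: "q \<in> CH K" "paraboloid q = paraboloid (z, t)" by auto
    moreover have "q \<in> hyp_space" using q(1) hyp_convex_CH by (auto simp: hyp_convex_def)
    moreover have "(z, t) \<in> hyp_space" using \<open>t > 0\<close> by (simp add: hyp_space_def)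
    ultimately have "(z, t) \<in> CH K" by (metis unparaboloid_paraboloid)
    then show ?thesis using tM by simp
  qed
  then show ?thesis unfolding z\<^sub>0_def[symmetric] by (intro exI[of _ t\<^sub>0]) auto
qed

text \<open>Every slab of the hull near the boundary has volume at least a fixed
  \<open>c > 0\<close>, whereas finite volume would make the volumes of shrinking slabs tend to
  0.\<close>

lemma hyp_volume_CH_infinite:
  assumes K: "continuum K" and nonflat: "interior (convex hull (lift ` {z. Some z \<in> K})) \<noteq> {}"
  shows "emeasure hyp_volume (CH K) = \<infinity>"
proof -
  define F where "F = {z. Some z \<in> K}"
  have H: "CH K \<subseteq> hyp_space" using hyp_convex_CH by (simp add: hyp_convex_def)
  obtain x where x: "x \<in> interior (convex hull (lift ` F))" using nonflat by (auto simp: F_def)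
  \<comment> \<open>The hull of an empty set or of a single point has empty interior, so there are
    two distinct finite points.\<close>
  obtain p0 where p0: "p0 \<in> F" using x by (cases "F = {}") auto
  obtain p1 where p1: "p1 \<in> F" "p1 \<noteq> p0"
  proof (rule ccontr)
    assume "\<not> thesis"
    with that p0 have "F = {p0}" by auto
    then show False using x by simp
  qed
  have int: "interior (convex hull (lift ` F)) \<subseteq> paraboloid ` CH K"
    unfolding F_def using p0 p1 by (intro interior_hull_lift_subset[of p0 K p1]) (auto simp: F_def)
  obtain \<rho> where \<rho>: "\<rho> > 0" "ball x \<rho> \<subseteq> convex hull (lift ` F)"
    using x by (auto simp: mem_interior)
  define m where "m = snd x - (norm (fst x))\<^sup>2"
  have "m > 0"
  proof -
    obtain q where "q \<in> CH K" "x = paraboloid q" using x int by blast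
    then show ?thesis using H paraboloid_above[of q] by (auto simp: m_def)
  qed
  define r where "r = norm (p1 - p0)"
  have "r > 0" using p1 by (simp add: r_def)
  \<comment> \<open>The bounds \<open>M\<close>, \<open>R\<close> and hence \<eta> serve all apexes
    within distance \<open>r\<close> of \<open>p0\<close> and all scales \<open>s \<le> 1\<close> at
    once.\<close>
  define M where "M = m + (norm (p0 - fst x) + r)\<^sup>2"
  define R where "R = norm p0 + r + norm (fst x)"
  have "M > 0" "R \<ge> 0" using \<open>m > 0\<close> \<open>r > 0\<close> by (simp_all add: M_def R_def add_pos_nonneg)
  define \<eta> where "\<eta> = min 1 (min (sqrt m / 2) (\<rho> / (4 + 2 * R + 2 * sqrt M)))"
  have den: "4 + 2 * R + 2 * sqrt M > 0" using \<open>M > 0\<close> \<open>R \<ge> 0\<close> by (simp add: add_pos_nonneg)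
  have \<eta>: "0 < \<eta>" "\<eta> \<le> 1" "\<eta> \<le> sqrt m / 2" "\<eta> * (4 + 2 * R + 2 * sqrt M) \<le> \<rho>"
  proof -
    show "0 < \<eta>" using \<open>m > 0\<close> \<rho>(1) den by (simp add: \<eta>_def)
    show "\<eta> \<le> 1" "\<eta> \<le> sqrt m / 2" unfolding \<eta>_def by linarith+
    have "\<eta> \<le> \<rho> / (4 + 2 * R + 2 * sqrt M)" by (simp add: \<eta>_def)
    then show "\<eta> * (4 + 2 * R + 2 * sqrt M) \<le> \<rho>" using den by (simp only: pos_le_divide_eq)
  qed
  define T where "T = sqrt M + 1"
  have "T > 0" using \<open>M > 0\<close> by (simp add: T_def add_pos_pos)
  have cyl: "\<exists>t\<^sub>0. ball ((1 - s) *\<^sub>R p + s *\<^sub>R fst x) (s * \<eta>) \<times> ball t\<^sub>0 (sqrt s * \<eta>)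
    \<subseteq> CH K \<inter> {q. snd q \<le> sqrt s * T}" if p: "p \<in> F" "norm (p - p0) \<le> r" and s: "0 < s" "s \<le> 1" for p s
    unfolding T_def
  proof (rule cylinder_subset_CH[OF _ s m_def \<open>m > 0\<close> _ _ \<eta>])
    show "ball ((1 - s) *\<^sub>R lift p + s *\<^sub>R x) (s * \<rho>) \<subseteq> paraboloid ` CH K"
      using cone_subset_interior_hull[OF imageI[OF p(1)] \<rho>(2) s] int by blast
    have "norm (p - fst x) \<le> norm (p0 - fst x) + r"
      using p(2) norm_triangle_ineq[of "p - p0" "p0 - fst x"] by simp
    then show "m + (norm (p - fst x))\<^sup>2 \<le> M" by (simp add: M_def power_mono)
    have "norm ((1 - s) *\<^sub>R p + s *\<^sub>R fst x) \<le> (1 - s) * norm p + s * norm (fst x)"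
      using s by (intro norm_triangle_le) simp
    also have "\<dots> \<le> 1 * norm p + 1 * norm (fst x)"
      using s by (intro add_mono mult_right_mono) auto
    also have "\<dots> \<le> R" using p(2) norm_triangle_ineq2[of p p0] by (simp add: R_def)
    finally show "norm ((1 - s) *\<^sub>R p + s *\<^sub>R fst x) \<le> R" .
  qed
  \<comment> \<open>One cylinder has Euclidean volume
    \<open>pi * (s * \<eta>)^2 * 2 * sqrt s * \<eta>\<close>; dividing by
    \<open>(sqrt s * T)^3\<close> leaves \<open>s * \<kappa>\<close>.\<close>
  define \<kappa> where "\<kappa> = 2 * pi * \<eta> ^ 3 / T ^ 3"
  have "\<kappa> > 0" using \<eta> \<open>T > 0\<close> by (simp add: \<kappa>_def)
  \<comment> \<open>With \<open>N\<close> cylinders at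
    \<open>s = r / (4 * \<eta> * (N + 1))\<close>, the estimate
    \<open>N / (N + 1) \<ge> 1 / 2\<close> bounds \<open>N * s * \<kappa>\<close> below by this
    constant.\<close>
  define c where "c = r * \<kappa> / (8 * \<eta>)"
  have "c > 0" using \<open>\<kappa> > 0\<close> \<open>r > 0\<close> \<eta> by (simp add: c_def)
  \<comment> \<open>Every scale \<open>s\<close> contributes a fixed amount of volume, because connectedness provides about \<open>1/s\<close>
    points of \<open>K\<close> at pairwise distance at least \<open>4 s \<eta>\<close>.\<close>
  have scale: "ennreal c \<le> emeasure hyp_volume (CH K \<inter> {q. snd q \<le> sqrt s * T})"
    if N: "N \<ge> 1" and s: "s = r / (4 * \<eta> * (real N + 1))" "s \<le> 1 / 2" for N :: nat and s
  proof -
    have "s > 0" unfolding s(1) using \<open>r > 0\<close> \<eta> by simp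
    have s4: "4 * s * \<eta> * (real N + 1) = r"
    proof -
      define D where "D = 4 * \<eta> * (real N + 1)"
      have "D > 0" unfolding D_def using \<eta> by simp
      then have "s * D = r" unfolding s(1) D_def[symmetric] by simp
      then show ?thesis by (simp add: D_def mult_ac)
    qed
    \<comment> \<open>As \<open>1 \<le> j \<le> N\<close>, the circle about \<open>p0\<close> of
      this radius separates \<open>p0\<close> from \<open>p1\<close>, so \<open>K\<close> crosses
      it.\<close>
    have "\<exists>w. w \<in> F \<and> norm (w - p0) = 4 * s * \<eta> * real j" if j: "j \<in> {1..N}" for j
    proof -
      have "4 * s * \<eta> * real j < 4 * s * \<eta> * (real N + 1)"
        using j \<open>s > 0\<close> \<eta> by (intro mult_strict_left_mono) auto
      then have "4 * s * \<eta> * real j < r" using s4 by simp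
      moreover have "4 * s * \<eta> * real j > 0" using j \<open>s > 0\<close> \<eta> by simp
      ultimately obtain v where "Some v \<in> K" "norm (v - p0) = 4 * s * \<eta> * real j"
        using p0 p1 by (auto simp: F_def r_def
          intro: continuum_crosses_circle[OF K, of p0 p0 "4 * s * \<eta> * real j" "Some p1"])
      then show ?thesis by (auto simp: F_def)
    qed
    then obtain w where w: "\<And>j. j \<in> {1..N} \<Longrightarrow> w j \<in> F" "\<And>j. j \<in> {1..N} \<Longrightarrow> norm (w j - p0) = 4 * s * \<eta> * real j"
      by metis
    have wr: "norm (w j - p0) \<le> r" if "j \<in> {1..N}" for j
    proof -
      have "4 * s * \<eta> * real j \<le> 4 * s * \<eta> * (real N + 1)"
        using that \<open>s > 0\<close> \<eta> by (intro mult_left_mono) auto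
      then show ?thesis using w(2)[OF that] s4 by simp
    qed
    define B where "B = (\<lambda>j. ball ((1 - s) *\<^sub>R w j + s *\<^sub>R fst x) (s * \<eta>))"
    have "\<exists>t\<^sub>0. B j \<times> ball t\<^sub>0 (sqrt s * \<eta>) \<subseteq> CH K \<inter> {q. snd q \<le> sqrt s * T}" if "j \<in> {1..N}" for j
      unfolding B_def using cyl[OF w(1)[OF that] wr[OF that] \<open>s > 0\<close>] s(2) by simp
    then obtain \<tau> where \<tau>: "\<And>j. j \<in> {1..N} \<Longrightarrow> B j \<times> ball (\<tau> j) (sqrt s * \<eta>) \<subseteq> CH K \<inter> {q. snd q \<le> sqrt s * T}"
      by metis
    define Q where "Q = (\<lambda>j. B j \<times> ball (\<tau> j) (sqrt s * \<eta>))"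
    \<comment> \<open>Moving towards \<open>fst x\<close> shrinks distances by
      \<open>1 - s \<ge> 1 / 2\<close>, so the spacing \<open>4 * s * \<eta>\<close> remains at
      least \<open>2 * s * \<eta>\<close>, the sum of the two radii.\<close>
    have Bdisj: "B i \<inter> B j = {}" if ij: "i \<in> {1..N}" "j \<in> {1..N}" "i \<noteq> j" for i j
    proof -
      have "2 * (s * \<eta>) \<le> (1 / 2) * (4 * s * \<eta> * \<bar>real i - real j\<bar>)"
        using ij \<open>s > 0\<close> \<eta> by simp
      also have "4 * s * \<eta> * \<bar>real i - real j\<bar> = \<bar>norm (w i - p0) - norm (w j - p0)\<bar>"
        using w(2)[OF ij(1)] w(2)[OF ij(2)] \<open>s > 0\<close> \<eta> by (simp add: abs_mult flip: right_diff_distrib)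
      also have "\<dots> \<le> norm (w i - w j)"
        using norm_triangle_ineq3[of "w i - p0" "w j - p0"] by simp
      also have "(1 / 2) * norm (w i - w j) \<le> (1 - s) * norm (w i - w j)"
        using s(2) by (intro mult_right_mono) auto
      also have "\<dots> = dist ((1 - s) *\<^sub>R w i + s *\<^sub>R fst x) ((1 - s) *\<^sub>R w j + s *\<^sub>R fst x)"
        using s(2) by (simp add: dist_norm flip: scaleR_diff_right)
      finally show ?thesis unfolding B_def by (intro disjoint_ballI) (simp only: mult_2)
    qed
    have disj: "disjoint_family_on Q {1..N}"
      unfolding disjoint_family_on_def Q_def using Bdisj by blast
    have Qm: "Q j \<in> sets lebesgue" for j
    proof -
      have "open (Q j)" unfolding Q_def B_def by (intro open_Times open_ball)
      then show ?thesis by simp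
    qed
    have Qvol: "ennreal (s * \<kappa>) \<le> emeasure hyp_volume (Q j)" if "j \<in> {1..N}" for j
    proof -
      have "ennreal (1 / (sqrt s * T) ^ 3) * emeasure lebesgue (Q j) \<le> emeasure hyp_volume (Q j)"
      proof (rule hyp_volume_ge[OF Qm])
        fix q assume "q \<in> Q j"
        then have "q \<in> CH K" "snd q \<le> sqrt s * T" using \<tau>[OF that] unfolding Q_def by auto
        then show "0 < snd q \<and> snd q \<le> sqrt s * T" using H by (auto simp: hyp_space_def)
      qed
      moreover have "emeasure lebesgue (Q j) = ennreal (pi * (s * \<eta>)\<^sup>2 * (2 * (sqrt s * \<eta>)))"
        unfolding Q_def B_def using \<open>s > 0\<close> \<eta> by (intro emeasure_lebesgue_cylinder) auto
      moreover have "1 / (sqrt s * T) ^ 3 * (pi * (s * \<eta>)\<^sup>2 * (2 * (sqrt s * \<eta>))) = s * \<kappa>"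
      proof -
        define u where "u = sqrt s"
        have "u > 0" "s = u\<^sup>2" using \<open>s > 0\<close> by (simp_all add: u_def)
        then show ?thesis
          unfolding u_def[symmetric] \<kappa>_def using \<open>T > 0\<close>
          by (simp add: power_mult_distrib field_simps power2_eq_square power3_eq_cube)
      qed
      ultimately show ?thesis
        using \<open>s > 0\<close> \<open>T > 0\<close> \<eta> by (simp add: ennreal_mult'[symmetric])
    qed
    have "c \<le> real N * (s * \<kappa>)"
    proof -
      have "real N * s = (r / (4 * \<eta>)) * (real N / (real N + 1))"
        unfolding s(1) by (simp add: field_simps)
      also have "\<dots> \<ge> (r / (4 * \<eta>)) * (1 / 2)"
        using N \<open>r > 0\<close> \<eta> by (intro mult_left_mono) (auto simp: field_simps)
      finally have "r / (8 * \<eta>) * \<kappa> \<le> real N * s * \<kappa>"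
        using \<open>\<kappa> > 0\<close> by (intro mult_right_mono) auto
      then show ?thesis by (simp add: c_def)
    qed
    then have "ennreal c \<le> ennreal (real N * (s * \<kappa>))" by (rule ennreal_leI)
    also have "\<dots> = (\<Sum>j\<in>{1..N}. ennreal (s * \<kappa>))"
      using \<open>s > 0\<close> \<open>\<kappa> > 0\<close> by (simp add: ennreal_mult ennreal_of_nat_eq_real_of_nat)
    also have "\<dots> \<le> (\<Sum>j\<in>{1..N}. emeasure hyp_volume (Q j))" by (intro sum_mono Qvol)
    also have "\<dots> = emeasure hyp_volume (\<Union>j\<in>{1..N}. Q j)"
      using Qm disj by (intro sum_emeasure) (auto simp: hyp_volume_def)
    also have "\<dots> \<le> emeasure hyp_volume (CH K \<inter> {q. snd q \<le> sqrt s * T})"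
    proof (rule emeasure_mono)
      show "(\<Union>j\<in>{1..N}. Q j) \<subseteq> CH K \<inter> {q. snd q \<le> sqrt s * T}" using \<tau> unfolding Q_def by blast
      have "closed {q::complex \<times> real. snd q \<le> sqrt s * T}" by (intro closed_Collect_le continuous_intros)
      then show "CH K \<inter> {q. snd q \<le> sqrt s * T} \<in> sets hyp_volume"
        using sets_lebesgue_CH by (auto simp: hyp_volume_def)
    qed
    finally show ?thesis .
  qed
  show ?thesis
  proof (rule ccontr)
    assume fin: "emeasure hyp_volume (CH K) \<noteq> \<infinity>"
    \<comment> \<open>These slabs decrease to the empty set because the hull lies at positive
      heights; continuity from above applies under finite volume.\<close>
    define A where "A = (\<lambda>n. CH K \<inter> {q. snd q \<le> inverse (real (Suc n))})"
    have Am: "A n \<in> sets hyp_volume" for n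
    proof -
      have "closed {q::complex \<times> real. snd q \<le> inverse (real (Suc n))}"
        by (intro closed_Collect_le continuous_intros)
      then show ?thesis using sets_lebesgue_CH by (auto simp: A_def hyp_volume_def)
    qed
    have "decseq A"
    proof (rule decseq_SucI)
      fix n
      have "inverse (real (Suc (Suc n))) \<le> inverse (real (Suc n))" by (intro le_imp_inverse_le) auto
      then show "A (Suc n) \<subseteq> A n" unfolding A_def by (blast intro: order_trans)
    qed
    moreover have "emeasure hyp_volume (A n) \<noteq> \<infinity>" for n
    proof -
      have "emeasure hyp_volume (A n) \<le> emeasure hyp_volume (CH K)"
        using sets_lebesgue_CH by (intro emeasure_mono) (auto simp: A_def hyp_volume_def)
      then show ?thesis using fin by (auto simp: top_unique)
    qed
    ultimately have lim: "(\<lambda>n. emeasure hyp_volume (A n)) \<longlonglongrightarrow> emeasure hyp_volume (\<Inter>n. A n)"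
      using Am by (intro Lim_emeasure_decseq) auto
    have "(\<Inter>n. A n) = {}"
    proof (intro equals0I)
      fix q assume q: "q \<in> (\<Inter>n. A n)"
      then have "snd q > 0" using H by (auto simp: A_def hyp_space_def)
      then obtain n where "inverse (real (Suc n)) < snd q" using reals_Archimedean by blast
      then show False using q by (auto simp: A_def not_le[symmetric])
    qed
    with lim have lim: "(\<lambda>n. emeasure hyp_volume (A n)) \<longlonglongrightarrow> 0" by simp
    have "ennreal c \<le> emeasure hyp_volume (A n)" for n
    proof -
      define \<delta> where "\<delta> = inverse (real (Suc n)) / T"
      have "\<delta> > 0" using \<open>T > 0\<close> by (simp add: \<delta>_def)
      \<comment> \<open>\<open>s \<le> 1 / 2\<close> is the hypothesis of \<open>scale\<close>, and
        \<open>s \<le> \<delta>^2\<close> places the slab of height \<open>sqrt s * T\<close> inside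
        \<open>A n\<close>.\<close>
      define e where "e = min (1 / 2) (\<delta>\<^sup>2)"
      have "e > 0" using \<open>\<delta> > 0\<close> by (simp add: e_def)
      obtain N where N: "r / (4 * \<eta> * e) < real N" using reals_Archimedean2 by blast
      define s where "s = r / (4 * \<eta> * (real N + 1))"
      have "r / (4 * \<eta> * e) > 0" using \<open>r > 0\<close> \<eta> \<open>e > 0\<close> by simp
      then have "N \<ge> 1" using N by (cases N) auto
      have "r < real N * (4 * \<eta> * e)" using N \<eta> \<open>e > 0\<close> by (simp add: pos_divide_less_eq)
      also have "\<dots> \<le> e * (4 * \<eta> * (real N + 1))" using \<eta> \<open>e > 0\<close> by (simp add: algebra_simps)
      finally have "s \<le> e" unfolding s_def using \<eta> by (simp add: pos_divide_le_eq)
      then have s: "s \<le> 1 / 2" "s \<le> \<delta>\<^sup>2" by (simp_all add: e_def)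
      have "sqrt s \<le> \<delta>" using s(2) \<open>\<delta> > 0\<close> by (simp add: real_le_lsqrt)
      then have "sqrt s * T \<le> inverse (real (Suc n))" using \<open>T > 0\<close> by (simp add: \<delta>_def pos_le_divide_eq)
      then have "CH K \<inter> {q. snd q \<le> sqrt s * T} \<subseteq> A n" by (auto simp: A_def)
      then have "emeasure hyp_volume (CH K \<inter> {q. snd q \<le> sqrt s * T}) \<le> emeasure hyp_volume (A n)"
        using Am by (rule emeasure_mono)
      then show ?thesis using scale[OF \<open>N \<ge> 1\<close> s_def s(1)] by (rule order_trans[rotated])
    qed
    then have "ennreal c \<le> 0" by (intro tendsto_lowerbound[OF lim]) auto
    then show False using \<open>c > 0\<close> by simp
  qed
qed

theorem theorem1p1:
  fixes K :: "complex option set"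
  assumes "continuum K"
  shows "(emeasure hyp_volume (CH K) = 0 \<or> emeasure hyp_volume (CH K) = \<infinity>) \<and>
         (emeasure hyp_volume (CH K) = 0 \<longleftrightarrow> (\<exists>C. sphere_circle C \<and> K \<subseteq> C))"
proof (cases "\<exists>C. sphere_circle C \<and> K \<subseteq> C")
  case True
  then obtain C where "sphere_circle C" and "K \<subseteq> C" by blast
  then obtain \<beta> \<alpha> b where "(\<beta>, \<alpha>) \<noteq> 0"
    and "\<And>z. Some z \<in> K \<Longrightarrow> (\<beta>, \<alpha>) \<bullet> lift z = b" "None \<in> K \<Longrightarrow> \<alpha> = 0"
    by (metis sphere_circle_plane subsetD)
  then have "negligible (CH K)"
    by (intro negligible_subset[OF negligible_plane CH_subset_plane])
  then show ?thesis using True hyp_volume_negligible by simp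
next
  case False
  then have "emeasure hyp_volume (CH K) = \<infinity>"
    using assms sphere_circle_if_flat hyp_volume_CH_infinite by blast
  then show ?thesis using False by simp
qed

end
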